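(* Let $p$ and $q$ be irreducible monic polynomials with degree $2$ over $\mathbb{F}$. Assume further that $q=H_d(p)$ for some $d\in\mathbb{F}\setminus\{0\}$, that $\operatorname{tr}p=0$ and that the characteristic of $\mathbb{F}$ is not $2$. Let $u$ be an endomorphism of a finite-dimensional vector space $V$ over $\mathbb{F}$. Then, the following conditions are equivalent: (i) $u$ is a q-exceptional $(p,q)$-quotient. (ii) The minimal polynomial of $u$ is the product of a power of $t-d$ with a power of $t+d$. Moreover, the invariant factors of $u$ read $s_1,s_2,\dots,s_{2k-1},s_{2k},\dots$ where, for every positive integer $k$, we have $s_{2k-1}=s_{2k}$. (iii) In some basis of $V$, the endomorphism $u$ is represented by a block-diagonal matrix in which every diagonal block equals $C\bigl((t-d)^n\bigr)\oplus C\bigl((t-d)^n\bigr)$ or $C\bigl((t+d)^n\bigr)\oplus C\bigl((t+d)^n\bigr)$ for some positive integer $n$.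
   Context: $\mathbb{F}$ is a field with algebraic closure $\overline{\mathbb{F}}$. For a monic polynomial $p$ of degree $n\ge 1$, $\operatorname{tr}(p)$ is the opposite of the coefficient of $p$ on $t^{n-1}$, and $\operatorname{Root}(p)$ is its set of roots in $\overline{\mathbb{F}}$. For $p$ monic of degree $2$ and $d\in\mathbb{F}\setminus\{0\}$, $H_d(p):=d^{-2}p(dt)$. An endomorphism $u$ of $V$ is a $(p,q)$-quotient if $u=ab^{-1}$ for some automorphisms $a,b$ of $V$ with $p(a)=0$ and $q(b)=0$. It is q-exceptional with respect to $(p,q)$ if all its eigenvalues in $\overline{\mathbb{F}}$ belong to $\operatorname{Root}(p)\operatorname{Root}(q)^{-1}=\{xy^{-1}: x\in\operatorname{Root}(p),\,y\in\operatorname{Root}(q)\}$; a q-exceptional $(p,q)$-quotient is a $(p,q)$-quotient that is q-exceptional with respect to $(p,q)$. $C(r)$ is the companion matrix of the monic polynomial $r$ ($C(1)$ is the $0\times0$ matrix), and $\oplus$ is block-diagonal sum. The invariant factors of $u$ are the monic polynomials $s_1,s_2,\dots$ with $s_{i+1}\mid s_i$ such that $u$ is represented in some basis by $C(s_1)\oplus C(s_2)\oplus\cdots$; the finite list of nonconstant ones is extended to an infinite sequence by $s_i=1$. *)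

theory Defs
  imports "HOL-Algebra.Algebraic_Closure_Type" "Jordan_Normal_Form.Char_Poly"
begin

text \<open>The algebraic closure of the field \<open>'a\<close> is the library type \<open>'a alg_closure\<close>, with
  embedding \<^const>\<open>to_ac\<close>. The vector space is a type \<open>'v\<close> with scalar multiplication \<open>scale\<close>;
  its endomorphisms are the functions \<open>u\<close> with \<open>linear scale scale u\<close>.\<close>

definition poly_tr :: "'a :: field poly \<Rightarrow> 'a" where
  "poly_tr p = - Polynomial.coeff p (Polynomial.degree p - 1)"

definition ac_roots :: "'a :: field poly \<Rightarrow> 'a alg_closure set" where
  "ac_roots p = {x. poly (map_poly to_ac p) x = 0}"

text \<open>The polynomial \<open>H\<^sub>d(p)\<close>, for \<open>p\<close> monic of degree 2.\<close>

definition H_poly :: "'a :: field \<Rightarrow> 'a poly \<Rightarrow> 'a poly" where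
  "H_poly d p = Polynomial.smult (inverse (d ^ 2)) (pcompose p [:0, d:])"

text \<open>Convention: ones on the subdiagonal and the negated coefficients in the last column.\<close>

definition companion_mat :: "'a :: field poly \<Rightarrow> 'a mat" where
  "companion_mat r = (let n = Polynomial.degree r in
     mat n n (\<lambda>(i, j). if j + 1 = n then - Polynomial.coeff r i else if i = j + 1 then 1 else 0))"

definition ordered_basis :: "('a :: field \<Rightarrow> 'v :: ab_group_add \<Rightarrow> 'v) \<Rightarrow> 'v list \<Rightarrow> bool" where
  "ordered_basis scale bs \<longleftrightarrow>
     distinct bs \<and> \<not> module.dependent scale (set bs) \<and> module.span scale (set bs) = UNIV"

text \<open>Column \<open>j\<close> of \<open>A\<close> holds the coordinates of the image under \<open>u\<close> of the \<open>j\<close>-th basis vector.\<close>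

definition represents ::
    "('a :: field \<Rightarrow> 'v :: ab_group_add \<Rightarrow> 'v) \<Rightarrow> 'v list \<Rightarrow> 'a mat \<Rightarrow> ('v \<Rightarrow> 'v) \<Rightarrow> bool" where
  "represents scale bs A u \<longleftrightarrow>
     ordered_basis scale bs \<and> A \<in> carrier_mat (length bs) (length bs) \<and>
     (\<forall>j < length bs. u (bs ! j) = (\<Sum>i < length bs. scale (A $$ (i, j)) (bs ! i)))"

definition poly_endo ::
    "('a :: field \<Rightarrow> 'v :: ab_group_add \<Rightarrow> 'v) \<Rightarrow> 'a poly \<Rightarrow> ('v \<Rightarrow> 'v) \<Rightarrow> 'v \<Rightarrow> 'v" where
  "poly_endo scale r u =
     (\<lambda>x. \<Sum>i \<le> Polynomial.degree r. scale (Polynomial.coeff r i) ((u ^^ i) x))"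

definition is_automorphism ::
    "('a :: field \<Rightarrow> 'v :: ab_group_add \<Rightarrow> 'v) \<Rightarrow> ('v \<Rightarrow> 'v) \<Rightarrow> bool" where
  "is_automorphism scale a \<longleftrightarrow> Vector_Spaces.linear scale scale a \<and> bij a"

definition pq_quotient ::
    "('a :: field \<Rightarrow> 'v :: ab_group_add \<Rightarrow> 'v) \<Rightarrow> 'a poly \<Rightarrow> 'a poly \<Rightarrow> ('v \<Rightarrow> 'v) \<Rightarrow> bool" where
  "pq_quotient scale p q u \<longleftrightarrow>
     (\<exists>a b. is_automorphism scale a \<and> is_automorphism scale b \<and>
        poly_endo scale p a = (\<lambda>_. 0) \<and> poly_endo scale q b = (\<lambda>_. 0) \<and> u = a \<circ> inv_into UNIV b)"

text \<open>The eigenvalues of \<open>u\<close> in the algebraic closure are those of the scalar extension of \<open>u\<close>,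
  that is, those of a matrix of \<open>u\<close> viewed over the closure; the basis does not matter.\<close>

definition ac_eigenvalues ::
    "('a :: field \<Rightarrow> 'v :: ab_group_add \<Rightarrow> 'v) \<Rightarrow> ('v \<Rightarrow> 'v) \<Rightarrow> 'a alg_closure set" where
  "ac_eigenvalues scale u =
     {x. \<exists>bs A. represents scale bs A u \<and> eigenvalue (map_mat to_ac A) x}"

definition q_exceptional ::
    "('a :: field \<Rightarrow> 'v :: ab_group_add \<Rightarrow> 'v) \<Rightarrow> 'a poly \<Rightarrow> 'a poly \<Rightarrow> ('v \<Rightarrow> 'v) \<Rightarrow> bool" where
  "q_exceptional scale p q u \<longleftrightarrow>
     ac_eigenvalues scale u \<subseteq> {x * inverse y | x y. x \<in> ac_roots p \<and> y \<in> ac_roots q}"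

definition is_minimal_poly ::
    "('a :: field \<Rightarrow> 'v :: ab_group_add \<Rightarrow> 'v) \<Rightarrow> ('v \<Rightarrow> 'v) \<Rightarrow> 'a poly \<Rightarrow> bool" where
  "is_minimal_poly scale u m \<longleftrightarrow>
     monic m \<and> poly_endo scale m u = (\<lambda>_. 0) \<and>
     (\<forall>r. poly_endo scale r u = (\<lambda>_. 0) \<longrightarrow> m dvd r)"

text \<open>The invariant factors are indexed from 1 (the value \<open>s 0\<close> is irrelevant). The number \<open>N\<close> may
  exceed the number of nonconstant ones, since \<open>companion_mat 1\<close> is the empty matrix.\<close>

definition is_invariant_factors ::
    "('a :: field \<Rightarrow> 'v :: ab_group_add \<Rightarrow> 'v) \<Rightarrow> ('v \<Rightarrow> 'v) \<Rightarrow> (nat \<Rightarrow> 'a poly) \<Rightarrow> bool" where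
  "is_invariant_factors scale u s \<longleftrightarrow>
     (\<forall>i \<ge> 1. monic (s i) \<and> s (i + 1) dvd s i) \<and>
     (\<exists>N. (\<forall>i > N. s i = 1) \<and>
        (\<exists>bs. represents scale bs
           (diag_block_mat (map (\<lambda>i. companion_mat (s i)) [1..<N + 1])) u))"

end

theory Submission
  imports Defs "HOL-Library.Function_Algebras"
begin

text \<open>Put \<open>c = - p(0)\<close>, so that \<open>p = t\<^sup>2 - c\<close> and \<open>q = t\<^sup>2 - c/d\<^sup>2\<close> where \<open>c\<close> is not a square. Then \<open>u\<close> is a
  \<open>(p,q)\<close>-quotient iff it is invertible and \<open>u a u = d\<^sup>2 a\<close> for some \<open>a\<close> with \<open>a\<^sup>2 = c\<close>, and it is
  q-exceptional iff it is killed by some \<open>(t - d)\<^sup>m (t + d)\<^sup>n\<close>.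

  Given such an \<open>a\<close>, take vectors \<open>x\<^sub>j\<close>, each killed by some \<open>(t - l\<^sub>j)\<^bsup>n\<^sub>j\<^esup>\<close> with \<open>l\<^sub>j = \<plusminus>d\<close>, that generate \<open>V\<close>
  under \<open>u\<close> and \<open>a\<close>, and minimize \<open>\<Sum> n\<^sub>j\<close>. Then \<open>V\<close> is the direct sum of the cyclic modules generated by the
  \<open>x\<^sub>j\<close> and the \<open>a x\<^sub>j\<close>, and both have the annihilator \<open>(t - l\<^sub>j)\<^bsup>n\<^sub>j\<^esup>\<close>: the blocks come in pairs. Conversely,
  on a pair of blocks with generators \<open>x\<close> and \<open>y\<close> the conditions \<open>a x = y\<close>, \<open>a y = c x\<close> and
  \<open>a u = d\<^sup>2 u\<^sup>-\<^sup>1 a\<close> define \<open>a\<close>, because \<open>t \<mapsto> d\<^sup>2/t\<close> preserves the ideals of the powers of \<open>t - d\<close> and of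
  \<open>t + d\<close>. The invariant factors and the paired blocks determine each other by the Chinese remainder
  theorem.\<close>

section \<open>Cyclic decompositions\<close>

text \<open>If u = a b^-1, then b = u^-1 a, and b^2 = c/d^2 unfolds to u a u = d^2 a. So
  \<open>a\<close> is not an endomorphism of the F[t]-module V; it twists the action by t -> d^2/t.
  The numbers d and -d are the fixed points of this involution and also the quotients of the roots
  of p by the roots of q, so on a q-exceptional quotient \<open>a\<close> preserves each primary
  component. They lie in F although the roots do not: all factors that occur are linear over F, and
  d \<noteq> -d makes the two components coprime. A cyclic decomposition for u alone does not
  exhibit the pairs, since \<open>a\<close> need not respect it. This is why generators are taken
  under u and a together. As c is not a square, F[a] is a field, and a nonzero coefficient alpha +
  beta a of a relation can be divided out. The eigenvalue condition lives over the closure, whereas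
  V is a type over F. The scalar extension is replaced by its dual, the F-linear maps from V to the
  closure.\<close>

locale vs_endo = vector_space scale
  for scale :: "'a :: field \<Rightarrow> 'v :: ab_group_add \<Rightarrow> 'v" (infixr \<open>*s\<close> 75) +
  fixes u :: "'v \<Rightarrow> 'v"
  assumes linear_u: "Vector_Spaces.linear scale scale u"
begin

abbreviation ev :: "'a poly \<Rightarrow> 'v \<Rightarrow> 'v" where
  "ev f \<equiv> poly_endo scale f u"

lemma u_add: "u (x + y) = u x + u y"
  and u_scale: "u (c *s x) = c *s u x"
  using linear_u unfolding Vector_Spaces.linear_iff by auto

lemma u_zero [simp]: "u 0 = 0"
  using u_scale[of 0 0] by simp

lemma u_diff: "u (x - y) = u x - u y"
  using u_add[of "x - y" y] by simp

lemma u_minus: "u (- x) = - u x"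
  using u_diff[of 0 x] by simp

lemma u_sum: "u (\<Sum>i\<in>I. g i) = (\<Sum>i\<in>I. u (g i))"
  by (induction I rule: infinite_finite_induct) (auto simp: u_add)

lemma ev_bound:
  assumes "Polynomial.degree f \<le> n"
  shows "ev f x = (\<Sum>i\<le>n. scale (Polynomial.coeff f i) ((u ^^ i) x))"
  unfolding poly_endo_def
  by (rule sum.mono_neutral_left) (use assms in \<open>auto simp: coeff_eq_0\<close>)

text \<open>Horner's rule. It makes evaluation a recursion on \<open>pCons\<close>, so most of the
  algebra of \<open>ev\<close> below is a short induction on the polynomial.\<close>

lemma ev_pCons [simp]: "ev (pCons a f) x = a *s x + u (ev f x)"
proof -
  have "ev (pCons a f) x =
    (\<Sum>i\<le>Suc (Polynomial.degree f). Polynomial.coeff (pCons a f) i *s (u ^^ i) x)"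
    by (rule ev_bound) (rule degree_pCons_le)
  also have "\<dots> = a *s x + (\<Sum>i\<le>Polynomial.degree f. Polynomial.coeff f i *s u ((u ^^ i) x))"
    by (simp only: sum.atMost_Suc_shift) simp
  also have "(\<Sum>i\<le>Polynomial.degree f. Polynomial.coeff f i *s u ((u ^^ i) x)) = u (ev f x)"
    by (simp add: poly_endo_def u_sum u_scale)
  finally show ?thesis .
qed

lemma ev_0 [simp]: "ev 0 x = 0"
  by (simp add: poly_endo_def)

lemma ev_1 [simp]: "ev 1 x = x"
  by (simp add: one_pCons)

lemma ev_add: "ev (f + g) x = ev f x + ev g x"
  by (induction f g rule: poly_induct2) (auto simp: u_add scale_left_distrib)

lemma ev_smult: "ev (Polynomial.smult c f) x = c *s ev f x"
  by (induction f) (auto simp: u_scale scale_right_distrib)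

lemma ev_minus: "ev (- f) x = - ev f x"
  using ev_smult[of "-1" f x] by simp

lemma ev_diff: "ev (f - g) x = ev f x - ev g x"
  using ev_add[of f "-g" x] by (simp add: ev_minus)

lemma ev_sum: "ev (\<Sum>i\<in>I. f i) x = (\<Sum>i\<in>I. ev (f i) x)"
  by (induction I rule: infinite_finite_induct) (auto simp: ev_add)

lemma ev_mult: "ev (f * g) x = ev f (ev g x)"
  by (induction f) (auto simp: ev_add ev_smult)

lemma ev_vadd: "ev f (x + y) = ev f x + ev f y"
  by (induction f) (auto simp: u_add scale_right_distrib)

lemma ev_vscale: "ev f (c *s x) = c *s ev f x"
  by (induction f) (auto simp: u_scale scale_right_distrib mult.commute)

lemma ev_vzero [simp]: "ev f 0 = 0"
  by (induction f) auto

lemma ev_vsum: "ev f (\<Sum>i\<in>I. x i) = (\<Sum>i\<in>I. ev f (x i))"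
  by (induction I rule: infinite_finite_induct) (auto simp: ev_vadd)

lemma ev_u: "ev f (u x) = u (ev f x)"
  by (induction f) (auto simp: u_add u_scale)

lemma pow_ev: "(u ^^ n) (ev f v) = ev f ((u ^^ n) v)"
  by (induction n) (auto simp: ev_u)

lemma pow_zero: "(u ^^ n) 0 = 0"
  by (induction n) auto

lemma ev_commute: "ev f (ev g x) = ev g (ev f x)"
  by (metis ev_mult mult.commute)

lemma ev_monom: "ev (monom c k) x = c *s (u ^^ k) x"
proof (induction k)
  case (Suc k)
  then show ?case by (simp add: monom_Suc u_scale)
qed (simp add: monom_0)

lemma ev_dvd:
  assumes "r dvd f" "ev r x = 0"
  shows "ev f x = 0"
  using assms by (auto simp: dvd_def ev_mult ev_commute[of r])

text \<open>\<open>V\<close> is the internal direct sum of the cyclic F[t]-modules generated by the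
  \<open>x i\<close>, with annihilator ideals (\<open>r i\<close>): the equivalence encodes
  directness and the annihilators at once. Trivial summands are allowed; \<open>r i = 1\<close>
  forces \<open>x i = 0\<close>.\<close>

definition cyclic_decomp :: "'i set \<Rightarrow> ('i \<Rightarrow> 'v) \<Rightarrow> ('i \<Rightarrow> 'a poly) \<Rightarrow> bool" where
  "cyclic_decomp I x r \<longleftrightarrow> finite I \<and>
     (\<forall>f. (\<Sum>i\<in>I. ev (f i) (x i)) = 0 \<longleftrightarrow> (\<forall>i\<in>I. r i dvd f i)) \<and>
     (\<forall>v. \<exists>f. v = (\<Sum>i\<in>I. ev (f i) (x i)))"

lemma cyclic_decompI:
  assumes "finite I" "\<And>i. i \<in> I \<Longrightarrow> ev (r i) (x i) = 0"
    and "\<And>f i. (\<Sum>i\<in>I. ev (f i) (x i)) = 0 \<Longrightarrow> i \<in> I \<Longrightarrow> r i dvd f i"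
    and "\<And>v. \<exists>f. v = (\<Sum>i\<in>I. ev (f i) (x i))"
  shows "cyclic_decomp I x r"
  unfolding cyclic_decomp_def
proof (intro conjI allI iffI)
  fix f assume "\<forall>i\<in>I. r i dvd f i"
  then show "(\<Sum>i\<in>I. ev (f i) (x i)) = 0"
    by (intro sum.neutral ballI ev_dvd[OF _ assms(2)]) auto
qed (use assms in blast)+

lemma cyclic_decomp_finite: "cyclic_decomp I x r \<Longrightarrow> finite I"
  and cyclic_decomp_dvd:
    "cyclic_decomp I x r \<Longrightarrow> (\<Sum>i\<in>I. ev (f i) (x i)) = 0 \<Longrightarrow> i \<in> I \<Longrightarrow> r i dvd f i"
  and cyclic_decomp_span: "cyclic_decomp I x r \<Longrightarrow> \<exists>f. v = (\<Sum>i\<in>I. ev (f i) (x i))"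
  unfolding cyclic_decomp_def by blast+

lemma cyclic_decomp_ann:
  assumes "cyclic_decomp I x r" "i \<in> I"
  shows "ev (r i) (x i) = 0"
proof -
  have "(\<Sum>j\<in>I. ev (if j = i then r i else 0) (x j)) = 0"
    using assms(1) unfolding cyclic_decomp_def by auto
  moreover have "(\<Sum>j\<in>I. ev (if j = i then r i else 0) (x j)) = ev (r i) (x i)"
    using cyclic_decomp_finite[OF assms(1)] assms(2)
    by (subst sum.remove[of _ i]) (auto intro!: sum.neutral)
  ultimately show ?thesis by simp
qed

text \<open>A polynomial kills the module exactly when it kills the generators. This gives the
  minimal polynomial from the invariant factors and an annihilator from the paired blocks.\<close>

lemma cyclic_decomp_ev_eq_0_iff:
  assumes "cyclic_decomp I x r"
  shows "(\<forall>v. ev m v = 0) \<longleftrightarrow> (\<forall>i\<in>I. r i dvd m)"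
proof
  assume "\<forall>v. ev m v = 0"
  then show "\<forall>i\<in>I. r i dvd m"
    using cyclic_decomp_dvd[OF assms, of "\<lambda>_. m"] by simp
next
  assume *: "\<forall>i\<in>I. r i dvd m"
  show "\<forall>v. ev m v = 0"
  proof
    fix v
    obtain f where "v = (\<Sum>i\<in>I. ev (f i) (x i))"
      using cyclic_decomp_span[OF assms] by blast
    then have "ev m v = (\<Sum>i\<in>I. ev (f i) (ev m (x i)))"
      by (simp add: ev_vsum ev_commute[of m])
    also have "\<dots> = 0"
      using * by (auto intro!: sum.neutral simp: ev_dvd[OF _ cyclic_decomp_ann[OF assms]])
    finally show "ev m v = 0" .
  qed
qed

lemma cyclic_decomp_reindex:
  assumes "cyclic_decomp I x r" "bij_betw \<phi> J I"
  shows "cyclic_decomp J (x \<circ> \<phi>) (r \<circ> \<phi>)"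
proof (rule cyclic_decompI)
  show "finite J"
    using assms bij_betw_finite cyclic_decomp_finite by blast
  have into: "\<phi> j \<in> I" if "j \<in> J" for j
    using assms(2) that by (auto dest: bij_betwE)
  show "ev ((r \<circ> \<phi>) j) ((x \<circ> \<phi>) j) = 0" if "j \<in> J" for j
    using cyclic_decomp_ann[OF assms(1) into[OF that]] by simp
  let ?\<psi> = "the_inv_into J \<phi>"
  have inv: "?\<psi> (\<phi> j) = j" if "j \<in> J" for j
    using assms(2) that by (auto simp: bij_betw_def the_inv_into_f_f)
  have reind: "(\<Sum>j\<in>J. ev (f j) ((x \<circ> \<phi>) j)) = (\<Sum>i\<in>I. ev (f (?\<psi> i)) (x i))" for f
    by (subst sum.reindex_bij_betw[OF assms(2), symmetric]) (auto simp: inv)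
  show "(r \<circ> \<phi>) j dvd f j" if "(\<Sum>j\<in>J. ev (f j) ((x \<circ> \<phi>) j)) = 0" "j \<in> J" for f j
    using cyclic_decomp_dvd[OF assms(1) that(1)[unfolded reind] into[OF that(2)]]
    by (simp add: inv that)
  show "\<exists>f. v = (\<Sum>j\<in>J. ev (f j) ((x \<circ> \<phi>) j))" for v
  proof -
    obtain f where "v = (\<Sum>i\<in>I. ev (f i) (x i))"
      using cyclic_decomp_span[OF assms(1)] by blast
    also have "\<dots> = (\<Sum>j\<in>J. ev ((f \<circ> \<phi>) j) ((x \<circ> \<phi>) j))"
      by (subst sum.reindex_bij_betw[OF assms(2), symmetric]) auto
    finally show ?thesis by blast
  qed
qed

lemma cyclic_decomp_cong:
  assumes "\<And>i. i \<in> I \<Longrightarrow> x i = y i" "\<And>i. i \<in> I \<Longrightarrow> r i = s i"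
  shows "cyclic_decomp I x r \<longleftrightarrow> cyclic_decomp I y s"
  using assms unfolding cyclic_decomp_def by (simp cong: sum.cong)

lemma cyclic_decomp_eq:
  assumes "cyclic_decomp I x r" "\<And>i. i \<in> I \<Longrightarrow> r i = s i"
  shows "cyclic_decomp I x s"
proof -
  have "cyclic_decomp I x r \<longleftrightarrow> cyclic_decomp I x s"
    by (rule cyclic_decomp_cong) (simp_all add: assms(2))
  then show ?thesis using assms(1) by simp
qed

text \<open>A generator with annihilator 1 is zero. Dropping such generators, and conversely adding
  them, reconciles the blocks, whose exponents are at least 1, with the invariant factors, which are
  padded with 1.\<close>

lemma cyclic_decomp_restrict:
  assumes "cyclic_decomp I x r" "J \<subseteq> I" "\<And>i. i \<in> I - J \<Longrightarrow> r i = 1"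
  shows "cyclic_decomp J x r"
proof (rule cyclic_decompI)
  have fin: "finite I" using assms(1) by (rule cyclic_decomp_finite)
  show "finite J" using fin assms(2) finite_subset by blast
  show "ev (r i) (x i) = 0" if "i \<in> J" for i
    using cyclic_decomp_ann[OF assms(1)] assms(2) that by blast
  have "x i = 0" if "i \<in> I - J" for i
    using cyclic_decomp_ann[OF assms(1), of i] assms(3)[OF that] that by simp
  then have eq: "(\<Sum>i\<in>I. ev (f i) (x i)) = (\<Sum>i\<in>J. ev (f i) (x i))" for f
    using fin assms(2) by (intro sum.mono_neutral_right) auto
  show "r i dvd f i" if "(\<Sum>i\<in>J. ev (f i) (x i)) = 0" "i \<in> J" for f i
    using cyclic_decomp_dvd[OF assms(1), of f i] that assms(2) by (auto simp: eq)
  show "\<exists>f. v = (\<Sum>i\<in>J. ev (f i) (x i))" for v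
    using cyclic_decomp_span[OF assms(1), of v] by (simp add: eq)
qed

lemma cyclic_decomp_extend:
  assumes "cyclic_decomp J x r" "J \<subseteq> I" "finite I" "\<And>i. i \<in> I - J \<Longrightarrow> r i = 1"
  shows "\<exists>y. cyclic_decomp I y r"
proof -
  let ?y = "\<lambda>i. if i \<in> J then x i else 0"
  have eq: "(\<Sum>i\<in>I. ev (f i) (?y i)) = (\<Sum>i\<in>J. ev (f i) (x i))" for f
  proof -
    have "(\<Sum>i\<in>I. ev (f i) (?y i)) = (\<Sum>i\<in>J. ev (f i) (?y i))"
      using assms(2,3) by (intro sum.mono_neutral_right) auto
    then show ?thesis by (simp cong: sum.cong)
  qed
  have "cyclic_decomp I ?y r"
  proof (rule cyclic_decompI)
    show "ev (r i) (?y i) = 0" if "i \<in> I" for i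
      using cyclic_decomp_ann[OF assms(1)] by simp
    show "r i dvd f i" if "(\<Sum>i\<in>I. ev (f i) (?y i)) = 0" "i \<in> I" for f i
      using cyclic_decomp_dvd[OF assms(1), of f i] that assms(4)[of i]
      unfolding eq by (cases "i \<in> J") auto
    show "\<exists>f. v = (\<Sum>i\<in>I. ev (f i) (?y i))" for v
      using cyclic_decomp_span[OF assms(1), of v] by (simp only: eq)
  qed fact
  then show ?thesis by blast
qed

lemma sum_times_bool:
  "(\<Sum>ib\<in>I \<times> (UNIV :: bool set). g ib) = (\<Sum>i\<in>I. g (i, True) + g (i, False))"
  by (simp add: sum.cartesian_product' UNIV_bool add.commute)

text \<open>Chinese remainder theorem: the sum of two generators with coprime annihilators generates
  both summands, and its annihilator is the product.\<close>

lemma cyclic_decomp_merge: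
  assumes "cyclic_decomp (I \<times> (UNIV :: bool set)) x (\<lambda>(i, b). if b then r i else s i)"
    and cop: "\<And>i. i \<in> I \<Longrightarrow> \<exists>A B. A * r i + B * s i = 1"
  shows "cyclic_decomp I (\<lambda>i. x (i, True) + x (i, False)) (\<lambda>i. r i * s i)"
proof (rule cyclic_decompI)
  note sum_times_bool[simp]
  show "finite I"
    using cyclic_decomp_finite[OF assms(1)] by (auto simp: finite_cartesian_product_iff)
  have zero: "ev (r i) (x (i, True)) = 0" "ev (s i) (x (i, False)) = 0" if "i \<in> I" for i
    using cyclic_decomp_ann[OF assms(1), of "(i, True)"]
      cyclic_decomp_ann[OF assms(1), of "(i, False)"] that by auto
  show "ev (r i * s i) (x (i, True) + x (i, False)) = 0" if "i \<in> I" for i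
    using zero[OF that] by (simp add: ev_vadd ev_mult ev_commute[of "r i" "s i"])
  show "r i * s i dvd f i"
    if "(\<Sum>i\<in>I. ev (f i) (x (i, True) + x (i, False))) = 0" "i \<in> I" for f i
  proof -
    have "(\<Sum>ib\<in>I \<times> UNIV. ev ((\<lambda>(i, b). f i) ib) (x ib)) = 0"
      using that(1) by (simp add: ev_vadd)
    then have d: "r i dvd f i" "s i dvd f i"
      using cyclic_decomp_dvd[OF assms(1), of "\<lambda>(i, b). f i" "(i, True)"]
        cyclic_decomp_dvd[OF assms(1), of "\<lambda>(i, b). f i" "(i, False)"] that(2) by auto
    from cop[OF that(2)] obtain A B where AB: "A * r i + B * s i = 1" by blast
    have "f i = f i * (A * r i + B * s i)" by (simp add: AB)
    also have "\<dots> = A * (r i * f i) + B * (s i * f i)" by (simp add: algebra_simps)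
    also have "r i * s i dvd \<dots>"
      using mult_dvd_mono[OF dvd_refl d(2), of "r i"] mult_dvd_mono[OF d(1) dvd_refl, of "s i"]
      by (intro dvd_add[OF dvd_mult dvd_mult]) (simp_all only: mult.commute)
    finally show ?thesis .
  qed
  show "\<exists>f. v = (\<Sum>i\<in>I. ev (f i) (x (i, True) + x (i, False)))" for v
  proof -
    obtain g where g: "v = (\<Sum>ib\<in>I \<times> UNIV. ev (g ib) (x ib))"
      using cyclic_decomp_span[OF assms(1)] by blast
    obtain A B where AB: "\<And>i. i \<in> I \<Longrightarrow> A i * r i + B i * s i = 1" using cop by metis
    \<comment> \<open>\<open>B i * s i\<close> acts as the identity on the first generator and as 0
      on the second, and \<open>A i * r i\<close> the other way round; so one polynomial realizes
      two independent coefficients.\<close>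
    have *: "ev (g (i, True) * (B i * s i) + g (i, False) * (A i * r i)) (x (i, True) + x (i, False))
        = ev (g (i, True)) (x (i, True)) + ev (g (i, False)) (x (i, False))"
      if "i \<in> I" for i
    proof -
      have "ev (A i * r i + B i * s i) y = y" for y using AB[OF that] by simp
      from this[of "x (i, True)"] this[of "x (i, False)"] zero[OF that]
      have "ev (B i) (ev (s i) (x (i, True))) = x (i, True)"
        "ev (A i) (ev (r i) (x (i, False))) = x (i, False)"
        by (auto simp: ev_add ev_mult)
      then show ?thesis
        using zero[OF that] by (simp add: ev_add ev_vadd ev_mult)
    qed
    have "v = (\<Sum>i\<in>I. ev (g (i, True) * (B i * s i) + g (i, False) * (A i * r i))
       (x (i, True) + x (i, False)))"
      unfolding g by (simp add: * cong: sum.cong)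
    then show ?thesis by - (rule exI)
  qed
qed

text \<open>The Chinese remainder theorem in the other direction: the multiple by \<open>s i\<close>
  of a generator has annihilator \<open>r i\<close>, and 1 = A r + B s recovers the generator from
  its two multiples.\<close>

lemma cyclic_decomp_split:
  assumes "cyclic_decomp I x (\<lambda>i. r i * s i)"
    and cop: "\<And>i. i \<in> I \<Longrightarrow> \<exists>A B. A * r i + B * s i = 1"
    and nz: "\<And>i. i \<in> I \<Longrightarrow> r i \<noteq> 0 \<and> s i \<noteq> 0"
  shows "cyclic_decomp (I \<times> (UNIV :: bool set))
    (\<lambda>(i, b). if b then ev (s i) (x i) else ev (r i) (x i)) (\<lambda>(i, b). if b then r i else s i)"
proof (rule cyclic_decompI)
  let ?x = "\<lambda>(i, b). if b then ev (s i) (x i) else ev (r i) (x i)"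
  show "finite (I \<times> (UNIV :: bool set))"
    using cyclic_decomp_finite[OF assms(1)] by auto
  have zero: "ev (r i) (ev (s i) (x i)) = 0" "ev (s i) (ev (r i) (x i)) = 0" if "i \<in> I" for i
    using cyclic_decomp_ann[OF assms(1) that] by (auto simp: ev_mult ev_commute[of "s i"])
  show "ev ((\<lambda>(i, b). if b then r i else s i) ib) (?x ib) = 0" if "ib \<in> I \<times> UNIV" for ib
    using zero that by (auto split: prod.splits)
  obtain A B where AB: "\<And>i. i \<in> I \<Longrightarrow> A i * r i + B i * s i = 1" using cop by metis
  have eq: "(\<Sum>ib\<in>I \<times> UNIV. ev (f ib) (?x ib))
    = (\<Sum>i\<in>I. ev (f (i, True) * s i + f (i, False) * r i) (x i))" for f
    by (simp add: sum_times_bool ev_add ev_mult)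
  show "(\<lambda>(i, b). if b then r i else s i) ib dvd f ib"
    if "(\<Sum>ib\<in>I \<times> UNIV. ev (f ib) (?x ib)) = 0" "ib \<in> I \<times> UNIV" for f ib
  proof -
    obtain i b where ib: "ib = (i, b)" by force
    then have i: "i \<in> I" using that(2) by auto
    have d: "r i * s i dvd f (i, True) * s i + f (i, False) * r i"
      using cyclic_decomp_dvd[OF assms(1) that(1)[unfolded eq] i] .
    have "r i dvd f (i, True) * s i"
      using d by (metis dvd_add_left_iff dvd_mult_left dvd_triv_right)
    then have "r i dvd f (i, True) * (A i * r i + B i * s i)"
      by (metis (no_types, lifting) distrib_left dvd_add dvd_mult dvd_mult2 dvd_triv_right
          mult.assoc mult.commute)
    moreover have "s i dvd f (i, False) * r i"
      using d by (metis dvd_add_right_iff dvd_mult_right dvd_triv_right)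
    then have "s i dvd f (i, False) * (A i * r i + B i * s i)"
      by (metis (no_types, lifting) distrib_left dvd_add dvd_mult dvd_mult2 dvd_triv_right
          mult.assoc mult.commute)
    ultimately show ?thesis
      using AB[OF i] ib by auto
  qed
  show "\<exists>f. v = (\<Sum>ib\<in>I \<times> UNIV. ev (f ib) (?x ib))" for v
  proof -
    obtain g where g: "v = (\<Sum>i\<in>I. ev (g i) (x i))"
      using cyclic_decomp_span[OF assms(1)] by blast
    have "v = (\<Sum>ib\<in>I \<times> UNIV. ev ((\<lambda>(i, b). g i * (if b then B i else A i)) ib) (?x ib))"
      unfolding eq g
    proof (rule sum.cong)
      fix i assume i: "i \<in> I"
      have "g i = g i * (A i * r i + B i * s i)" by (simp add: AB[OF i])
      also have "\<dots> = (g i * B i) * s i + (g i * A i) * r i" by (simp add: algebra_simps)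
      finally show "ev (g i) (x i) = ev ((\<lambda>(i, b). g i * (if b then B i else A i)) (i, True) * s i +
           (\<lambda>(i, b). g i * (if b then B i else A i)) (i, False) * r i) (x i)" by simp
    qed simp
    then show ?thesis by - (rule exI)
  qed
qed

end

section \<open>Companion matrices\<close>

text \<open>Replaces positions in a block-diagonal matrix by pairs (block, position inside the
  block). In the induction the positions of the new first block stay, and all others are shifted by
  its size.\<close>

lemma diag_block_mat_index_bij:
  assumes "\<And>B. B \<in> set Bs \<Longrightarrow> square_mat B"
  shows "\<exists>\<phi>. bij_betw \<phi> (SIGMA i:{..<length Bs}. {..<dim_row (Bs ! i)}) {..<dim_row (diag_block_mat Bs)}
    \<and> (\<forall>p \<in> (SIGMA i:{..<length Bs}. {..<dim_row (Bs ! i)}).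
       \<forall>q \<in> (SIGMA i:{..<length Bs}. {..<dim_row (Bs ! i)}).
        diag_block_mat Bs $$ (\<phi> p, \<phi> q) =
          (if fst p = fst q then (Bs ! fst p) $$ (snd p, snd q) else 0))"
  using assms
proof (induction Bs)
  case Nil
  then show ?case by (auto simp: bij_betw_def)
next
  case (Cons B Bs)
  let ?S = "SIGMA i:{..<length Bs}. {..<dim_row (Bs ! i)}"
  let ?S' = "SIGMA i:{..<length (B # Bs)}. {..<dim_row ((B # Bs) ! i)}"
  let ?D = "diag_block_mat Bs" and ?n = "dim_row B"
  obtain \<phi> where \<phi>: "bij_betw \<phi> ?S {..<dim_row ?D}"
    and entry: "\<And>p q. p \<in> ?S \<Longrightarrow> q \<in> ?S \<Longrightarrow> ?D $$ (\<phi> p, \<phi> q) =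
          (if fst p = fst q then (Bs ! fst p) $$ (snd p, snd q) else 0)"
    using Cons by (metis list.set_intros(2))
  have sqB: "dim_col B = ?n" and sqD: "dim_col ?D = dim_row ?D"
    using Cons.prems diag_block_mat_square[of Bs] by (auto simp: square_mat.simps)
  have D': "diag_block_mat (B # Bs) = four_block_mat B (0\<^sub>m ?n (dim_row ?D)) (0\<^sub>m (dim_row ?D) ?n) ?D"
    using sqB sqD by (simp add: Let_def)
  define \<psi> where "\<psi> = (\<lambda>(i, j). case i of 0 \<Rightarrow> j | Suc i' \<Rightarrow> ?n + \<phi> (i', j))"
  have \<phi>_less: "\<phi> p < dim_row ?D" if "p \<in> ?S" for p
    using \<phi> that by (auto dest: bij_betwE)
  have cases: "(\<exists>j. p = (0, j) \<and> j < ?n) \<or> (\<exists>i j. p = (Suc i, j) \<and> (i, j) \<in> ?S)"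
    if "p \<in> ?S'" for p
    using that by (cases p; cases "fst p") auto
  have \<psi>_simps [simp]: "\<psi> (0, j) = j" "\<psi> (Suc i, j) = ?n + \<phi> (i, j)" for i j
    by (auto simp: \<psi>_def)
  have "inj_on \<psi> ?S'"
  proof (rule inj_onI)
    fix p q assume p: "p \<in> ?S'" and q: "q \<in> ?S'" and eq: "\<psi> p = \<psi> q"
    note inj = inj_onD[OF bij_betw_imp_inj_on[OF \<phi>]]
    from cases[OF p] cases[OF q] show "p = q"
    proof (elim disjE exE conjE)
      fix i j i' j' assume "p = (Suc i, j)" "q = (Suc i', j')" "(i, j) \<in> ?S" "(i', j') \<in> ?S"
      then show ?thesis using eq inj[of "(i, j)" "(i', j')"] by simp
    qed (use eq in simp_all)
  qed
  moreover have "\<psi> ` ?S' = {..<?n + dim_row ?D}"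
  proof (intro equalityI subsetI)
    fix k assume "k \<in> \<psi> ` ?S'"
    then obtain p where p: "p \<in> ?S'" and k: "k = \<psi> p" by blast
    from cases[OF p] show "k \<in> {..<?n + dim_row ?D}"
      using \<phi>_less by (elim disjE exE conjE) (simp_all add: k)
  next
    fix k assume k: "k \<in> {..<?n + dim_row ?D}"
    show "k \<in> \<psi> ` ?S'"
    proof (cases "k < ?n")
      case True
      then show ?thesis by (intro image_eqI[of _ _ "(0, k)"]) auto
    next
      case False
      then have "k - ?n \<in> \<phi> ` ?S"
        using k \<phi> by (auto simp: bij_betw_def)
      then obtain p where "p \<in> ?S" "\<phi> p = k - ?n" by auto
      then show ?thesis
        using False by (intro image_eqI[of _ _ "(Suc (fst p), snd p)"]) auto
    qed
  qed
  ultimately have "bij_betw \<psi> ?S' {..<dim_row (diag_block_mat (B # Bs))}"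
    unfolding D' by (simp add: bij_betw_def)
  moreover have "diag_block_mat (B # Bs) $$ (\<psi> p, \<psi> q) =
      (if fst p = fst q then ((B # Bs) ! fst p) $$ (snd p, snd q) else 0)"
    if "p \<in> ?S'" "q \<in> ?S'" for p q
    using cases[OF that(1)] cases[OF that(2)]
  proof (elim disjE exE conjE)
    fix j j' assume "p = (0, j)" "q = (0, j')" "j < ?n" "j' < ?n"
    then show ?thesis unfolding D' using sqB sqD by simp
  next
    fix j i' j' assume "p = (0, j)" "q = (Suc i', j')" "j < ?n" "(i', j') \<in> ?S"
    then show ?thesis unfolding D' using sqB sqD \<phi>_less[of "(i', j')"] by simp
  next
    fix i j j' assume "p = (Suc i, j)" "q = (0, j')" "(i, j) \<in> ?S" "j' < ?n"
    then show ?thesis unfolding D' using sqB sqD \<phi>_less[of "(i, j)"] by simp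
  next
    fix i j i' j' assume "p = (Suc i, j)" "q = (Suc i', j')" "(i, j) \<in> ?S" "(i', j') \<in> ?S"
    then show ?thesis unfolding D'
      using sqB sqD \<phi>_less[of "(i, j)"] \<phi>_less[of "(i', j')"] entry[of "(i, j)" "(i', j')"]
      by simp
  qed
  ultimately show ?case by blast
qed

lemma companion_mat_dim [simp]:
  "dim_row (companion_mat r) = Polynomial.degree r"
  "dim_col (companion_mat r) = Polynomial.degree r"
  by (simp_all add: companion_mat_def Let_def)

section \<open>Indexed bases and the passage between companion blocks and generators\<close>

context vs_endo
begin

text \<open>With an arbitrary finite index set, the vectors \<open>(u ^^ j) (x i)\<close> can be
  indexed by the pairs \<open>(i, j)\<close>; an order is chosen only when a matrix has to be
  produced.\<close>

definition basis_family :: "'i set \<Rightarrow> ('i \<Rightarrow> 'v) \<Rightarrow> bool" where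
  "basis_family K b \<longleftrightarrow> finite K \<and>
     (\<forall>a. (\<Sum>k\<in>K. a k *s b k) = 0 \<longrightarrow> (\<forall>k\<in>K. a k = 0)) \<and>
     (\<forall>v. \<exists>a. v = (\<Sum>k\<in>K. a k *s b k))"

lemma basis_family_finite: "basis_family K b \<Longrightarrow> finite K"
  and basis_familyD: "basis_family K b \<Longrightarrow> (\<Sum>k\<in>K. a k *s b k) = 0 \<Longrightarrow> k \<in> K \<Longrightarrow> a k = 0"
  and basis_family_span: "basis_family K b \<Longrightarrow> \<exists>a. v = (\<Sum>k\<in>K. a k *s b k)"
  unfolding basis_family_def by blast+

lemma basis_family_iff:
  assumes "finite K"
  shows "basis_family K b \<longleftrightarrow> inj_on b K \<and> independent (b ` K) \<and> span (b ` K) = UNIV"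
proof
  assume bf: "basis_family K b"
  have inj: "inj_on b K"
  proof (rule inj_onI, rule ccontr)
    fix i j assume ij: "i \<in> K" "j \<in> K" "b i = b j" "i \<noteq> j"
    let ?a = "\<lambda>k. if k = i then 1 else if k = j then - 1 else 0"
    have "(\<Sum>k\<in>K. ?a k *s b k) = (\<Sum>k\<in>{i, j}. ?a k *s b k)"
      using assms ij by (intro sum.mono_neutral_right) auto
    also have "\<dots> = 0" using ij by simp
    finally show False using basis_familyD[OF bf _ ij(1), of ?a] by simp
  qed
  have "independent (b ` K)"
    unfolding dependent_finite[OF finite_imageI[OF assms]]
  proof safe
    fix c k assume k: "k \<in> K" "c (b k) \<noteq> 0" and "(\<Sum>v\<in>b ` K. c v *s v) = 0"
    then have "(\<Sum>k\<in>K. c (b k) *s b k) = 0" by (simp add: sum.reindex[OF inj])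
    then show False using basis_familyD[OF bf _ k(1), of "\<lambda>k. c (b k)"] k by blast
  qed
  moreover have "v \<in> span (b ` K)" for v
  proof -
    obtain a where "v = (\<Sum>k\<in>K. a k *s b k)" using bf unfolding basis_family_def by blast
    then show ?thesis by (simp add: span_sum span_scale span_base)
  qed
  ultimately show "inj_on b K \<and> independent (b ` K) \<and> span (b ` K) = UNIV"
    using inj by blast
next
  assume *: "inj_on b K \<and> independent (b ` K) \<and> span (b ` K) = UNIV"
  then have inj: "inj_on b K" by blast
  have "a k = 0" if a: "(\<Sum>k\<in>K. a k *s b k) = 0" and k: "k \<in> K" for a k
  proof -
    let ?c = "\<lambda>v. a (the_inv_into K b v)"
    have "(\<Sum>v\<in>b ` K. ?c v *s v) = 0"
      using a by (simp add: sum.reindex[OF inj] the_inv_into_f_f[OF inj] cong: sum.cong_simp)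
    then have "?c (b k) = 0"
      using independentD[OF _ finite_imageI[OF assms] order_refl, of b ?c "b k"] * k by blast
    then show ?thesis by (simp add: the_inv_into_f_f[OF inj k])
  qed
  moreover have "\<exists>a. v = (\<Sum>k\<in>K. a k *s b k)" for v
  proof -
    have "v \<in> range (\<lambda>c. \<Sum>v\<in>b ` K. c v *s v)"
      using * span_finite[OF finite_imageI[OF assms], of b] by auto
    then show ?thesis by (auto simp: sum.reindex[OF inj])
  qed
  ultimately show "basis_family K b" using assms unfolding basis_family_def by blast
qed

lemma ordered_basis_iff: "ordered_basis scale bs \<longleftrightarrow> basis_family {..<length bs} (nth bs)"
proof -
  have "nth bs ` {..<length bs} = set bs" by (auto simp: set_conv_nth)
  moreover have "distinct bs \<longleftrightarrow> inj_on ((!) bs) {..<length bs}"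
    by (auto simp: distinct_conv_nth inj_on_def)
  ultimately show ?thesis
    by (simp add: basis_family_iff ordered_basis_def)
qed

lemma basis_family_reindex:
  assumes "basis_family K b" "bij_betw \<phi> J K"
  shows "basis_family J (b \<circ> \<phi>)"
proof -
  have "finite J" "finite K"
    using assms bij_betw_finite unfolding basis_family_def by blast+
  then show ?thesis
    using assms comp_inj_on[of \<phi> J b]
    by (auto simp: basis_family_iff bij_betw_def image_comp)
qed

lemma sum_companion_column:
  assumes "j < Polynomial.degree r"
  shows "(\<Sum>k<Polynomial.degree r. (companion_mat r $$ (k, j)) *s b k) =
    (if Suc j < Polynomial.degree r then b (Suc j)
     else - (\<Sum>k<Polynomial.degree r. Polynomial.coeff r k *s b k))"
proof (cases "Suc j < Polynomial.degree r")
  case True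
  then have "(\<Sum>k<Polynomial.degree r. (companion_mat r $$ (k, j)) *s b k) =
    (\<Sum>k<Polynomial.degree r. if k = Suc j then b k else 0)"
    using assms by (intro sum.cong) (auto simp: companion_mat_def Let_def)
  then show ?thesis using True by simp
next
  case False
  then have "(\<Sum>k<Polynomial.degree r. (companion_mat r $$ (k, j)) *s b k) =
    (\<Sum>k<Polynomial.degree r. - (Polynomial.coeff r k *s b k))"
    using assms by (intro sum.cong) (auto simp: companion_mat_def Let_def)
  then show ?thesis using False by (simp add: sum_negf)
qed

lemma ev_monic:
  assumes "monic r"
  shows "ev r x = (\<Sum>k<Polynomial.degree r. Polynomial.coeff r k *s (u ^^ k) x)
    + (u ^^ Polynomial.degree r) x"
  unfolding poly_endo_def using assms by (simp add: lessThan_Suc_atMost[symmetric])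

lemma ev_less:
  assumes "f = 0 \<or> Polynomial.degree f < n"
  shows "ev f x = (\<Sum>k<n. Polynomial.coeff f k *s (u ^^ k) x)"
proof (cases n)
  case (Suc m)
  then have "Polynomial.degree f \<le> m" using assms by auto
  then show ?thesis by (simp add: ev_bound Suc lessThan_Suc_atMost)
qed (use assms in auto)

lemma ev_mod:
  assumes "ev r x = 0" "r \<noteq> 0"
  shows "ev f x = (\<Sum>k<Polynomial.degree r. Polynomial.coeff (f mod r) k *s (u ^^ k) x)"
proof -
  have "ev f x = ev (f div r * r + f mod r) x" by simp
  also have "\<dots> = ev (f mod r) x"
    unfolding ev_add ev_mult assms(1) by simp
  also have "\<dots> = (\<Sum>k<Polynomial.degree r. Polynomial.coeff (f mod r) k *s (u ^^ k) x)"
    by (rule ev_less) (use assms(2) degree_mod_less in blast)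
  finally show ?thesis .
qed

definition companion_family :: "'i set \<Rightarrow> ('i \<Rightarrow> 'a poly) \<Rightarrow> ('i \<times> nat \<Rightarrow> 'v) \<Rightarrow> bool" where
  "companion_family I r b \<longleftrightarrow>
     basis_family (SIGMA i:I. {..<Polynomial.degree (r i)}) b \<and>
     (\<forall>i\<in>I. \<forall>j<Polynomial.degree (r i). u (b (i, j)) =
        (\<Sum>k<Polynomial.degree (r i). (companion_mat (r i) $$ (k, j)) *s b (i, k)))"

text \<open>Division with remainder by \<open>r i\<close> shows that these vectors span; they are
  independent because a nonzero multiple of \<open>r i\<close> cannot have smaller degree than
  \<open>r i\<close>.\<close>

lemma cyclic_decomp_imp_companion_family:
  assumes "cyclic_decomp I x r" "\<And>i. i \<in> I \<Longrightarrow> monic (r i)"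
  shows "companion_family I r (\<lambda>(i, j). (u ^^ j) (x i))"
proof -
  let ?b = "\<lambda>(i, j). (u ^^ j) (x i)"
  let ?d = "\<lambda>i. Polynomial.degree (r i)"
  let ?S = "SIGMA i:I. {..<?d i}"
  have fin: "finite I" using assms(1) by (rule cyclic_decomp_finite)
  have sum_eq: "(\<Sum>p\<in>?S. a p *s ?b p) = (\<Sum>i\<in>I. ev (\<Sum>j<?d i. monom (a (i, j)) j) (x i))" for a
    using fin by (simp add: ev_sum ev_monom sum.Sigma split_def)
  have "basis_family ?S ?b"
    unfolding basis_family_def
  proof (intro conjI allI impI ballI)
    show "finite ?S" using fin by auto
    fix a p assume a: "(\<Sum>p\<in>?S. a p *s ?b p) = 0" and p: "p \<in> ?S"
    obtain i j where ij: "p = (i, j)" "i \<in> I" "j < ?d i" using p by auto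
    let ?f = "\<Sum>j<?d i. monom (a (i, j)) j"
    have coeff: "Polynomial.coeff ?f k = (if k < ?d i then a (i, k) else 0)" for k
      by (simp add: coeff_sum)
    have "r i dvd ?f"
      using cyclic_decomp_dvd[OF assms(1) a[unfolded sum_eq] ij(2)] .
    moreover have "Polynomial.degree ?f < ?d i"
      using ij(3) by (intro degree_lessI) (auto simp: coeff)
    ultimately have "?f = 0"
      by (meson dvd_imp_degree_le not_le)
    then have "Polynomial.coeff ?f j = 0" by simp
    then show "a p = 0" using ij by (simp add: coeff)
  next
    fix v
    obtain f where f: "v = (\<Sum>i\<in>I. ev (f i) (x i))"
      using cyclic_decomp_span[OF assms(1)] by blast
    have "ev (f i) (x i) = (\<Sum>j<?d i. Polynomial.coeff (f i mod r i) j *s (u ^^ j) (x i))"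
      if i: "i \<in> I" for i
      by (rule ev_mod[OF cyclic_decomp_ann[OF assms(1) i]]) (use assms(2)[OF i] in auto)
    then have "v = (\<Sum>p\<in>?S. (\<lambda>(i, j). Polynomial.coeff (f i mod r i) j) p *s ?b p)"
      unfolding f using fin by (simp add: sum.Sigma split_def)
    then show "\<exists>a. v = (\<Sum>p\<in>?S. a p *s ?b p)" by blast
  qed
  moreover have "u (?b (i, j)) = (\<Sum>k<?d i. (companion_mat (r i) $$ (k, j)) *s ?b (i, k))"
    if i: "i \<in> I" and j: "j < ?d i" for i j
  proof (cases "Suc j < ?d i")
    case True
    then show ?thesis using sum_companion_column[OF j, of "\<lambda>k. ?b (i, k)"] by simp
  next
    case False
    then have "?d i = Suc j" using j by simp
    then have "u (?b (i, j)) = (u ^^ ?d i) (x i)" by simp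
    also have "\<dots> = - (\<Sum>k<?d i. Polynomial.coeff (r i) k *s (u ^^ k) (x i))"
      using ev_monic[OF assms(2)[OF i], of "x i"] cyclic_decomp_ann[OF assms(1) i]
      by (metis add.commute eq_neg_iff_add_eq_0)
    finally show ?thesis using sum_companion_column[OF j, of "\<lambda>k. ?b (i, k)"] False by simp
  qed
  ultimately show ?thesis unfolding companion_family_def by blast
qed

text \<open>The ones below the diagonal give \<open>b (i, j) = (u ^^ j) (b (i, 0))\<close>, and the
  last column then says that \<open>r i\<close> kills \<open>b (i, 0)\<close>.\<close>

lemma companion_family_imp_cyclic_decomp:
  assumes "companion_family I r b" "finite I" "\<And>i. i \<in> I \<Longrightarrow> monic (r i)"
  shows "cyclic_decomp I (\<lambda>i. if Polynomial.degree (r i) = 0 then 0 else b (i, 0)) r"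
proof -
  let ?d = "\<lambda>i. Polynomial.degree (r i)"
  let ?S = "SIGMA i:I. {..<?d i}"
  \<comment> \<open>A block of degree 0 has no basis vector; its generator is 0, as the annihilator
    1 demands.\<close>
  define x where "x = (\<lambda>i. if ?d i = 0 then 0 else b (i, 0))"
  have bf: "basis_family ?S b" using assms(1) unfolding companion_family_def by blast
  have ub: "u (b (i, j)) = (if Suc j < ?d i then b (i, Suc j)
     else - (\<Sum>k<?d i. Polynomial.coeff (r i) k *s b (i, k)))" if "i \<in> I" "j < ?d i" for i j
    using assms(1) that sum_companion_column[OF that(2), of "\<lambda>k. b (i, k)"]
    unfolding companion_family_def by simp
  have pow: "(u ^^ j) (x i) = b (i, j)" if "i \<in> I" "j < ?d i" for i j
    using that(2)
  proof (induction j)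
    case (Suc j)
    then show ?case using ub[OF that(1), of j] by simp
  qed (auto simp: x_def)
  have ann: "ev (r i) (x i) = 0" if i: "i \<in> I" for i
  proof (cases "?d i")
    case (Suc m)
    have "ev (r i) (x i) = (\<Sum>k<?d i. Polynomial.coeff (r i) k *s b (i, k)) + u ((u ^^ m) (x i))"
      using ev_monic[OF assms(3)[OF i], of "x i"] pow[OF i] by (simp add: Suc)
    also have "\<dots> = 0"
      using pow[OF i, of m] ub[OF i, of m] by (simp only: Suc) simp
    finally show ?thesis .
  qed (use assms(3)[OF i] in \<open>auto simp: x_def\<close>)
  have sum_eq: "(\<Sum>i\<in>I. \<Sum>j<?d i. a i j *s b (i, j)) = (\<Sum>p\<in>?S. a (fst p) (snd p) *s b p)" for a
    using assms(2) by (simp add: sum.Sigma split_def)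
  have "cyclic_decomp I x r"
  proof (rule cyclic_decompI)
    show "finite I" by fact
    show "r i dvd f i" if "(\<Sum>i\<in>I. ev (f i) (x i)) = 0" "i \<in> I" for f i
    proof -
      have nz: "r i \<noteq> 0" if "i \<in> I" for i using assms(3)[OF that] by auto
      have "ev (f i) (x i) = (\<Sum>j<?d i. Polynomial.coeff (f i mod r i) j *s b (i, j))"
        if i: "i \<in> I" for i
        unfolding ev_mod[OF ann[OF i] nz[OF i]] by (rule sum.cong) (simp_all add: pow i)
      then have z: "(\<Sum>p\<in>?S. Polynomial.coeff (f (fst p) mod r (fst p)) (snd p) *s b p) = 0"
        using that(1) sum_eq[of "\<lambda>i j. Polynomial.coeff (f i mod r i) j"] by simp
      have z': "Polynomial.coeff (f i mod r i) j = 0" if "j < ?d i" for j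
        using basis_familyD[OF bf z, of "(i, j)"] \<open>i \<in> I\<close> that by simp
      have "f i mod r i = 0"
        using degree_mod_less[OF nz[OF \<open>i \<in> I\<close>], of "f i"] z'[of "Polynomial.degree (f i mod r i)"]
        by auto
      then show ?thesis by (simp add: mod_eq_0_iff_dvd)
    qed
    show "\<exists>f. v = (\<Sum>i\<in>I. ev (f i) (x i))" for v
    proof -
      obtain a where "v = (\<Sum>p\<in>?S. a p *s b p)" using bf unfolding basis_family_def by blast
      also have "\<dots> = (\<Sum>i\<in>I. ev (\<Sum>j<?d i. monom (a (i, j)) j) (x i))"
        using sum_eq[of "\<lambda>i j. a (i, j)"]
        by (auto simp: ev_sum ev_monom pow intro!: sum.cong)
      finally show ?thesis by - (rule exI)
    qed
  qed (rule ann)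
  then show ?thesis unfolding x_def .
qed

lemma ex_represents:
  assumes "finite B" "independent B" "span B = UNIV"
  shows "\<exists>bs A. represents scale bs A u"
proof -
  obtain bs where bs: "set bs = B" "distinct bs" using finite_distinct_list[OF assms(1)] by blast
  have ob: "ordered_basis scale bs" using assms bs by (simp add: ordered_basis_def)
  then have bf: "basis_family {..<length bs} (nth bs)" by (simp add: ordered_basis_iff)
  have "\<forall>j. \<exists>r. u (bs ! j) = (\<Sum>i<length bs. r i *s bs ! i)"
    using basis_family_span[OF bf] by blast
  then obtain r where r: "\<And>j. u (bs ! j) = (\<Sum>i<length bs. r j i *s bs ! i)" by metis
  have "represents scale bs (mat (length bs) (length bs) (\<lambda>(i, j). r j i)) u"
    unfolding represents_def using ob by (simp add: r)
  then show ?thesis by - (rule exI, rule exI)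
qed

text \<open>Conditions (ii) and (iii) both speak of companion blocks; through this equivalence they
  are treated by generators and annihilators alone.\<close>

lemma represents_companion_iff:
  assumes "\<And>r. r \<in> set rs \<Longrightarrow> monic r"
  shows "(\<exists>bs. represents scale bs (diag_block_mat (map companion_mat rs)) u) \<longleftrightarrow>
    (\<exists>x. cyclic_decomp {..<length rs} x (nth rs))"
proof -
  let ?A = "diag_block_mat (map companion_mat rs)"
  let ?d = "\<lambda>i. Polynomial.degree (rs ! i)"
  let ?S = "SIGMA i:{..<length rs}. {..<?d i}"
  have monic: "monic (rs ! i)" if "i \<in> {..<length rs}" for i
    using assms that by auto
  have sq: "\<And>B. B \<in> set (map companion_mat rs) \<Longrightarrow> square_mat B" by auto
  have S: "(SIGMA i:{..<length (map companion_mat rs)}. {..<dim_row (map companion_mat rs ! i)}) = ?S"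
    by (auto simp: set_eq_iff)
  obtain \<phi> where \<phi>: "bij_betw \<phi> ?S {..<dim_row ?A}" and entry:
    "\<And>p q. p \<in> ?S \<Longrightarrow> q \<in> ?S \<Longrightarrow> ?A $$ (\<phi> p, \<phi> q) =
          (if fst p = fst q then (map companion_mat rs ! fst p) $$ (snd p, snd q) else 0)"
    using diag_block_mat_index_bij[of "map companion_mat rs", OF sq] unfolding S by blast
  have sqA: "dim_col ?A = dim_row ?A"
    using diag_block_mat_square[of "map companion_mat rs"] sq by auto
  have column: "(\<Sum>p\<in>?S. (?A $$ (\<phi> p, \<phi> (i, j))) *s b p) =
      (\<Sum>k<?d i. (companion_mat (rs ! i) $$ (k, j)) *s b (i, k))"
    if ij: "(i, j) \<in> ?S" for b i j
  proof -
    have "(\<Sum>p\<in>?S. (?A $$ (\<phi> p, \<phi> (i, j))) *s b p)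
      = (\<Sum>p\<in>?S. (if fst p = i then companion_mat (rs ! i) $$ (snd p, j) else 0) *s b p)"
      using ij by (intro sum.cong) (auto simp: entry)
    also have "\<dots> = (\<Sum>p\<in>{i} \<times> {..<?d i}.
        (if fst p = i then companion_mat (rs ! i) $$ (snd p, j) else 0) *s b p)"
      using ij by (intro sum.mono_neutral_right) auto
    also have "\<dots> = (\<Sum>k<?d i. (companion_mat (rs ! i) $$ (k, j)) *s b (i, k))"
      by (simp add: sum.cartesian_product')
    finally show ?thesis .
  qed
  show ?thesis
  proof
    assume "\<exists>bs. represents scale bs ?A u"
    then obtain bs where bs: "basis_family {..<length bs} (nth bs)"
      "?A \<in> carrier_mat (length bs) (length bs)"
      "\<And>j. j < length bs \<Longrightarrow> u (bs ! j) = (\<Sum>i<length bs. (?A $$ (i, j)) *s bs ! i)"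
      unfolding represents_def ordered_basis_iff by blast
    have len: "length bs = dim_row ?A" using bs(2) by auto
    have "companion_family {..<length rs} (nth rs) (nth bs \<circ> \<phi>)"
      unfolding companion_family_def
    proof (intro conjI ballI allI impI)
      show "basis_family ?S (nth bs \<circ> \<phi>)"
        using basis_family_reindex[OF bs(1)] \<phi> unfolding len by blast
      fix i j assume "i \<in> {..<length rs}" "j < ?d i"
      then have ij: "(i, j) \<in> ?S" by auto
      then have "\<phi> (i, j) < length bs" using \<phi> len by (auto dest!: bij_betwE)
      then have "u ((nth bs \<circ> \<phi>) (i, j)) = (\<Sum>k<length bs. (?A $$ (k, \<phi> (i, j))) *s bs ! k)"
        using bs(3) by simp
      also have "\<dots> = (\<Sum>p\<in>?S. (?A $$ (\<phi> p, \<phi> (i, j))) *s bs ! \<phi> p)"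
        unfolding len by (rule sum.reindex_bij_betw[OF \<phi>, symmetric])
      also have "\<dots> = (\<Sum>k<?d i. (companion_mat (rs ! i) $$ (k, j)) *s (nth bs \<circ> \<phi>) (i, k))"
        using column[OF ij, of "nth bs \<circ> \<phi>"] by simp
      finally show "u ((nth bs \<circ> \<phi>) (i, j)) = \<dots>" .
    qed
    then show "\<exists>x. cyclic_decomp {..<length rs} x (nth rs)"
      by (intro exI) (rule companion_family_imp_cyclic_decomp[OF _ finite_lessThan monic])
  next
    assume "\<exists>x. cyclic_decomp {..<length rs} x (nth rs)"
    then obtain x where x: "cyclic_decomp {..<length rs} x (nth rs)" ..
    obtain b where b: "companion_family {..<length rs} (nth rs) b"
      using cyclic_decomp_imp_companion_family[OF x monic] by blast
    let ?\<psi> = "the_inv_into ?S \<phi>"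
    have \<psi>: "bij_betw ?\<psi> {..<dim_row ?A} ?S"
      using \<phi> by (rule bij_betw_the_inv_into)
    have \<psi>\<phi>: "?\<psi> (\<phi> p) = p" if "p \<in> ?S" for p
      using \<phi> that by (auto simp: bij_betw_def the_inv_into_f_f)
    have \<phi>\<psi>: "\<phi> (?\<psi> k) = k" if "k < dim_row ?A" for k
      using \<phi> that by (auto simp: bij_betw_def f_the_inv_into_f)
    define bs where "bs = map (b \<circ> ?\<psi>) [0..<dim_row ?A]"
    have bs_nth: "bs ! k = b (?\<psi> k)" if "k < dim_row ?A" for k
      using that by (simp add: bs_def)
    have len: "length bs = dim_row ?A" by (simp add: bs_def)
    have "represents scale bs ?A u"
      unfolding represents_def ordered_basis_iff len
    proof (intro conjI allI impI)
      have "basis_family {..<dim_row ?A} (b \<circ> ?\<psi>)"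
        using basis_family_reindex[OF _ \<psi>] b unfolding companion_family_def by blast
      then show "basis_family {..<dim_row ?A} (nth bs)"
        by (simp add: basis_family_def bs_nth cong: sum.cong_simp)
      show "?A \<in> carrier_mat (dim_row ?A) (dim_row ?A)" using sqA by auto
      fix l assume l: "l < dim_row ?A"
      obtain i j where ij: "?\<psi> l = (i, j)" by force
      then have S: "(i, j) \<in> ?S" using bij_betw_apply[OF \<psi>, of l] l by simp
      have \<phi>ij: "\<phi> (i, j) = l" using \<phi>\<psi>[OF l] ij by simp
      have "u (bs ! l) = u (b (i, j))" using l ij by (simp add: bs_nth)
      also have "\<dots> = (\<Sum>k<?d i. (companion_mat (rs ! i) $$ (k, j)) *s b (i, k))"
        using b S unfolding companion_family_def by auto
      also have "\<dots> = (\<Sum>p\<in>?S. (?A $$ (\<phi> p, l)) *s b p)"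
        using column[OF S, of b] by (simp add: \<phi>ij)
      also have "\<dots> = (\<Sum>p\<in>?S. (?A $$ (\<phi> p, l)) *s b (?\<psi> (\<phi> p)))"
        by (intro sum.cong) (auto simp: \<psi>\<phi>)
      also have "\<dots> = (\<Sum>k<dim_row ?A. (?A $$ (k, l)) *s b (?\<psi> k))"
        by (rule sum.reindex_bij_betw[OF \<phi>])
      finally show "u (bs ! l) = (\<Sum>k<dim_row ?A. (?A $$ (k, l)) *s bs ! k)"
        by (simp add: bs_nth cong: sum.cong_simp)
    qed
    then show "\<exists>bs. represents scale bs ?A u" ..
  qed
qed

end

section \<open>Paired blocks and invariant factors\<close>

lemma bezout_mult:
  fixes x y z :: "'a :: comm_ring_1"
  assumes "\<exists>A B. A * x + B * z = 1" "\<exists>A B. A * y + B * z = 1"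
  shows "\<exists>A B. A * (x * y) + B * z = 1"
proof -
  obtain A B where 1: "A * x + B * z = 1" using assms(1) by blast
  obtain C D where 2: "C * y + D * z = 1" using assms(2) by blast
  have "(A * C) * (x * y) + (A * x * D + B) * z = A * x * (C * y + D * z) + B * z"
    by (simp add: algebra_simps)
  also have "\<dots> = 1" by (simp add: 2 1)
  finally show ?thesis by blast
qed

lemma bezout_power:
  fixes x z :: "'a :: comm_ring_1"
  assumes "\<exists>A B. A * x + B * z = 1"
  shows "\<exists>A B. A * x ^ n + B * z = 1"
proof (induction n)
  case 0
  then show ?case by (intro exI[of _ 1] exI[of _ 0]) simp
next
  case (Suc n)
  then show ?case using bezout_mult[OF assms] by simp
qed

text \<open>(t - b) - (t - a) = a - b is a nonzero constant, and coprimality passes to powers, one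
  side at a time.\<close>

lemma bezout_linear_powers:
  fixes a b :: "'a :: field"
  assumes "a \<noteq> b"
  shows "\<exists>A B. A * [:- a, 1:] ^ m + B * [:- b, 1:] ^ n = 1"
proof -
  have swap: "\<exists>A B. A * x + B * z = 1 \<Longrightarrow> \<exists>A B. A * z + B * x = 1" for x z :: "'a poly"
    by (metis add.commute)
  have "a * inverse (a - b) - b * inverse (a - b) = 1"
    using assms by (simp flip: left_diff_distrib)
  then have "[:- inverse (a - b):] * [:- a, 1:] + [:inverse (a - b):] * [:- b, 1:] = 1"
    by (simp add: one_pCons)
  then have "\<exists>A B. A * [:- a, 1:] + B * [:- b, 1:] = 1" by blast
  from bezout_power[OF swap[OF bezout_power[OF this]]] show ?thesis by (rule swap)
qed

lemma monic_linear_power: "monic ([:- a, 1:] ^ n :: 'a :: field poly)"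
  by (simp add: monic_power)

text \<open>The factors t - c are cancelled one by one: if c is a root of \<open>r\<close>, the
  factor leaves \<open>r\<close> and is counted in \<open>k\<close>; otherwise c is a root of the
  cofactor and the factor disappears there.\<close>

lemma dvd_linear_power_mult:
  fixes r y :: "'a :: field poly"
  assumes "r dvd [:- c, 1:] ^ m * y"
  shows "\<exists>k r'. r = [:- c, 1:] ^ k * r' \<and> r' dvd y"
  using assms
proof (induction m arbitrary: r)
  case 0
  then show ?case by (intro exI[of _ 0] exI[of _ r]) simp
next
  case (Suc m)
  define l where "l = [:- c, 1:]"
  have nz: "l \<noteq> 0" by (simp add: l_def)
  obtain g where g: "l * (l ^ m * y) = r * g"
    using Suc.prems unfolding l_def[symmetric] power_Suc mult.assoc by (rule dvdE)
  have "\<exists>k r'. r = l ^ k * r' \<and> r' dvd y"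
  proof (cases "poly r c = 0")
    case True
    then obtain r1 where r1: "r = l * r1" unfolding poly_eq_0_iff_dvd l_def by (rule dvdE)
    have "l * (l ^ m * y) = l * (r1 * g)" unfolding g r1 by (rule mult.assoc)
    then have "l ^ m * y = r1 * g" using mult_left_cancel[OF nz] by blast
    then have "r1 dvd l ^ m * y" by (rule dvdI)
    then obtain k r' where "r1 = l ^ k * r'" "r' dvd y" using Suc.IH unfolding l_def by blast
    then show ?thesis using r1 by (intro exI[of _ "Suc k"] exI[of _ r']) (simp add: mult.assoc)
  next
    case False
    have "poly (r * g) c = 0" unfolding g[symmetric] by (simp add: l_def)
    then have "poly g c = 0" using False by simp
    then obtain g1 where g1: "g = l * g1" unfolding poly_eq_0_iff_dvd l_def by (rule dvdE)
    have "l * (l ^ m * y) = l * (r * g1)" unfolding g g1 by (rule mult.left_commute)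
    then have "l ^ m * y = r * g1" using mult_left_cancel[OF nz] by blast
    then have "r dvd l ^ m * y" by (rule dvdI)
    then show ?thesis using Suc.IH unfolding l_def by blast
  qed
  then show ?case unfolding l_def .
qed

lemma monic_dvd_linear_powers:
  fixes r :: "'a :: field poly"
  assumes "monic r" "r dvd [:- a, 1:] ^ m * [:- b, 1:] ^ n"
  shows "\<exists>k l. r = [:- a, 1:] ^ k * [:- b, 1:] ^ l"
proof -
  obtain k r1 where 1: "r = [:- a, 1:] ^ k * r1" "r1 dvd [:- b, 1:] ^ n * 1"
    using dvd_linear_power_mult[OF assms(2)] by auto
  obtain l r2 where 2: "r1 = [:- b, 1:] ^ l * r2" "r2 dvd 1"
    using dvd_linear_power_mult[OF 1(2)] by blast
  have "monic r2"
    using assms(1) unfolding 1 2 by (simp add: lead_coeff_mult lead_coeff_power)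
  then have "r2 = 1" using 2(2) by (metis is_unit_poly_iff lead_coeff_pCons(2) one_pCons)
  then show ?thesis using 1 2 by auto
qed

text \<open>For sorting the exponents of the blocks in decreasing order, so that the products of
  powers of equal rank form a divisibility chain.\<close>

lemma ex_antimono_enumeration:
  fixes n :: "'j \<Rightarrow> nat"
  assumes "finite J"
  shows "\<exists>\<phi>. bij_betw \<phi> {..<card J} J \<and> (\<forall>i j. i \<le> j \<longrightarrow> j < card J \<longrightarrow> n (\<phi> j) \<le> n (\<phi> i))"
proof -
  obtain xs where xs: "set xs = J" "distinct xs"
    using finite_distinct_list[OF assms] by blast
  let ?ys = "sort_key (\<lambda>j. - int (n j)) xs"
  have len: "length ?ys = card J" using distinct_card[OF xs(2)] xs(1) by simp
  have "bij_betw (nth ?ys) {..<card J} J"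
    by (rule bij_betw_nth) (use xs in \<open>simp_all add: len[symmetric]\<close>)
  moreover have "n (?ys ! j) \<le> n (?ys ! i)" if "i \<le> j" "j < card J" for i j
  proof -
    have "sorted (map (\<lambda>j. - int (n j)) ?ys)" by simp
    from sorted_nth_mono[OF this that(1)] show ?thesis using that len by simp
  qed
  ultimately show ?thesis by blast
qed

text \<open>Flattens the nested blocks of condition (iii) into one list of companion matrices, the
  form that \<open>represents_companion_iff\<close> handles.\<close>

lemma diag_block_mat_pairs:
  "diag_block_mat (map (\<lambda>A. diag_block_mat [A, A]) As) = diag_block_mat (concat (map (\<lambda>A. [A, A]) As))"
proof (induction As)
  case (Cons A As)
  let ?F = "\<lambda>A. diag_block_mat [A, A]"
  have "diag_block_mat (map ?F (A # As)) =
      (let C = ?F A; B = diag_block_mat (map ?F As)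
       in four_block_mat C (0\<^sub>m (dim_row C) (dim_col B)) (0\<^sub>m (dim_row B) (dim_col C)) B)"
    unfolding list.map Let_def by (rule diag_block_mat.simps(2)[unfolded Let_def])
  also have "\<dots> = diag_block_mat ([A, A] @ concat (map (\<lambda>A. [A, A]) As))"
    unfolding diag_block_mat_append Cons.IH by (rule refl)
  finally show ?case by simp
qed simp

lemma concat_pairs:
  "length (concat (map (\<lambda>x. [x, x]) xs)) = 2 * length xs"
  "m < 2 * length xs \<Longrightarrow> concat (map (\<lambda>x. [x, x]) xs) ! m = xs ! (m div 2)"
proof -
  show "length (concat (map (\<lambda>x. [x, x]) xs)) = 2 * length xs"
    by (induction xs) auto
  show "m < 2 * length xs \<Longrightarrow> concat (map (\<lambda>x. [x, x]) xs) ! m = xs ! (m div 2)"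
  proof (induction xs arbitrary: m)
    case (Cons x xs)
    consider "m = 0" | "m = 1" | m' where "m = Suc (Suc m')" by (metis One_nat_def not0_implies_Suc)
    then show ?case using Cons by cases auto
  qed simp
qed

lemma bij_betw_div_mod_2: "bij_betw (\<lambda>i. (i div 2, odd i)) {..<2 * n :: nat} ({..<n} \<times> (UNIV :: bool set))"
  by (rule bij_betw_byWitness[where f' = "\<lambda>(k, b). 2 * k + of_bool b"]) auto

lemma bij_betw_double: "bij_betw (\<lambda>(k, b). 2 * k + of_bool b) ({..<n} \<times> (UNIV :: bool set)) {..<2 * n :: nat}"
  by (rule bij_betw_byWitness[where f' = "\<lambda>i. (i div 2, odd i)"]) auto

context vs_endo
begin

text \<open>The summands \<open>C((t - l)\<^sup>n) \<oplus> C((t - l)\<^sup>n)\<close> are listed by the pairs \<open>(l, n)\<close>.\<close>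

definition paired_decomp :: "'a \<Rightarrow> bool" where
  "paired_decomp d \<longleftrightarrow> (\<exists>L :: ('a \<times> nat) list.
     (\<forall>(l, n) \<in> set L. l \<in> {d, - d} \<and> n \<ge> 1) \<and>
     (\<exists>x. cyclic_decomp ({..<length L} \<times> (UNIV :: bool set)) x
        (\<lambda>(k, b). [:- fst (L ! k), 1:] ^ snd (L ! k))))"

text \<open>Relaxes the form of the definition: any index set will do and exponents may be 0. The
  indices with exponent 0 are dropped and the others enumerated.\<close>

lemma paired_decompI:
  assumes cyc: "cyclic_decomp (J \<times> (UNIV :: bool set)) x (\<lambda>(j, b). [:- l j, 1:] ^ n j)"
    and l: "\<And>j. j \<in> J \<Longrightarrow> l j \<in> {d, - d}"
  shows "paired_decomp d"
proof -
  define J' where "J' = {j \<in> J. n j \<noteq> 0}"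
  have "finite J"
    using cyclic_decomp_finite[OF cyc] by (auto simp: finite_cartesian_product_iff)
  then have "finite J'" by (simp add: J'_def)
  then obtain h where h: "bij_betw h {0..<card J'} J'"
    using ex_bij_betw_nat_finite by blast
  define L where "L = map (\<lambda>k. (l (h k), n (h k))) [0..<card J']"
  have hJ: "h k \<in> J'" if "k < card J'" for k
    using bij_betwE[OF h] that by auto
  have "cyclic_decomp (J' \<times> (UNIV :: bool set)) x (\<lambda>(j, b). [:- l j, 1:] ^ n j)"
  proof (rule cyclic_decomp_restrict[OF cyc])
    show "(case i of (j, b) \<Rightarrow> [:- l j, 1:] ^ n j) = 1" if "i \<in> J \<times> UNIV - J' \<times> UNIV" for i
      using that by (cases i) (simp add: J'_def)
  qed (auto simp: J'_def)
  moreover have "bij_betw (map_prod h id) ({0..<card J'} \<times> (UNIV :: bool set)) (J' \<times> UNIV)"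
    using h by (rule bij_betw_map_prod) (rule bij_betw_id)
  ultimately have "cyclic_decomp ({0..<card J'} \<times> (UNIV :: bool set)) (x \<circ> map_prod h id)
      ((\<lambda>(j, b). [:- l j, 1:] ^ n j) \<circ> map_prod h id)"
    by (rule cyclic_decomp_reindex)
  moreover have "{0..<card J'} = {..<length L}" by (simp add: L_def lessThan_atLeast0)
  ultimately have "cyclic_decomp ({..<length L} \<times> (UNIV :: bool set)) (x \<circ> map_prod h id)
      ((\<lambda>(j, b). [:- l j, 1:] ^ n j) \<circ> map_prod h id)"
    by simp
  then have "cyclic_decomp ({..<length L} \<times> (UNIV :: bool set)) (x \<circ> map_prod h id)
      (\<lambda>(k, b). [:- fst (L ! k), 1:] ^ snd (L ! k))"
    by (rule cyclic_decomp_eq) (auto simp: L_def)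
  then have "\<exists>x. cyclic_decomp ({..<length L} \<times> (UNIV :: bool set)) x
      (\<lambda>(k, b). [:- fst (L ! k), 1:] ^ snd (L ! k))"
    by - (rule exI)
  moreover have "\<forall>(l, n) \<in> set L. l \<in> {d, - d} \<and> n \<ge> 1"
    using hJ l by (fastforce simp: L_def J'_def)
  ultimately show ?thesis unfolding paired_decomp_def by blast
qed

text \<open>Condition (iii) in terms of generators. After flattening, the two copies of block
  \<open>k\<close> occupy the places 2k and 2k + 1, whence the halving of indices.\<close>

lemma represents_pairs_iff:
  "(\<exists>bs Bs. represents scale bs (diag_block_mat Bs) u \<and>
     (\<forall>B \<in> set Bs. \<exists>n \<ge> 1.
        B = diag_block_mat [companion_mat ([:- d, 1:] ^ n), companion_mat ([:- d, 1:] ^ n)] \<or>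
        B = diag_block_mat [companion_mat ([:d, 1:] ^ n), companion_mat ([:d, 1:] ^ n)]))
   \<longleftrightarrow> paired_decomp d"
proof -
  define P :: "'a \<times> nat \<Rightarrow> 'a poly" where "P = (\<lambda>p. [:- fst p, 1:] ^ snd p)"
  define F where "F = (\<lambda>p. diag_block_mat [companion_mat (P p), companion_mat (P p)])"
  let ?ok = "\<lambda>(l, n). l \<in> {d, - d} \<and> n \<ge> (1 :: nat)"
  have F_pair: "diag_block_mat [companion_mat ([:- d, 1:] ^ n), companion_mat ([:- d, 1:] ^ n)] = F (d, n)"
    "diag_block_mat [companion_mat ([:d, 1:] ^ n), companion_mat ([:d, 1:] ^ n)] = F (- d, n)" for n
    by (simp_all only: F_def P_def fst_conv snd_conv minus_minus)
  have ok: "(\<exists>n \<ge> 1. B = F (d, n) \<or> B = F (- d, n)) \<longleftrightarrow> (\<exists>p. B = F p \<and> ?ok p)" for B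
    by force
  have blocks: "diag_block_mat (map F L) = diag_block_mat (map companion_mat (concat (map (\<lambda>r. [r, r]) (map P L))))"
    for L
  proof -
    have "map F L = map (\<lambda>A. diag_block_mat [A, A]) (map (\<lambda>p. companion_mat (P p)) L)"
      by (simp only: F_def map_map o_def)
    moreover have "concat (map (\<lambda>A. [A, A]) (map (\<lambda>p. companion_mat (P p)) L)) =
        map companion_mat (concat (map (\<lambda>r. [r, r]) (map P L)))"
      by (simp add: map_concat o_def)
    ultimately show ?thesis by (simp only: diag_block_mat_pairs)
  qed
  have "(\<exists>bs. represents scale bs (diag_block_mat (map F L)) u) \<longleftrightarrow>
      (\<exists>x. cyclic_decomp ({..<length L} \<times> (UNIV :: bool set)) x
        (\<lambda>(k, b). [:- fst (L ! k), 1:] ^ snd (L ! k)))" for L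
  proof -
    define rs where "rs = concat (map (\<lambda>r. [r, r]) (map P L))"
    let ?I = "{..<length L} \<times> (UNIV :: bool set)"
    let ?r = "\<lambda>(k, b). [:- fst (L ! k), 1:] ^ snd (L ! k)"
    have len: "length rs = 2 * length L"
      unfolding rs_def concat_pairs(1) by simp
    have monic: "monic r" if "r \<in> set rs" for r
      using that by (auto simp: rs_def P_def monic_linear_power)
    have nth: "rs ! m = [:- fst (L ! (m div 2)), 1:] ^ snd (L ! (m div 2))" if "m < 2 * length L" for m
    proof -
      have "rs ! m = map P L ! (m div 2)" unfolding rs_def by (rule concat_pairs(2)) (use that in simp)
      also have "\<dots> = P (L ! (m div 2))" by (rule nth_map) (use that in linarith)
      finally show ?thesis by (simp only: P_def)
    qed
    have "(\<exists>bs. represents scale bs (diag_block_mat (map F L)) u) \<longleftrightarrow>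
        (\<exists>x. cyclic_decomp {..<2 * length L} x (nth rs))"
      using represents_companion_iff[of rs] monic unfolding blocks rs_def[symmetric] len by blast
    also have "\<dots> \<longleftrightarrow> (\<exists>x. cyclic_decomp ?I x ?r)"
    proof (intro iffI; elim exE)
      fix x assume "cyclic_decomp {..<2 * length L} x (nth rs)"
      from cyclic_decomp_reindex[OF this bij_betw_double]
      have "cyclic_decomp ?I (x \<circ> (\<lambda>(k, b). 2 * k + of_bool b)) ?r"
        by (rule cyclic_decomp_eq)
          (auto simp: nth)
      then show "\<exists>x. cyclic_decomp ?I x ?r" by - (rule exI)
    next
      fix x assume "cyclic_decomp ?I x ?r"
      from cyclic_decomp_reindex[OF this bij_betw_div_mod_2]
      have "cyclic_decomp {..<2 * length L} (x \<circ> (\<lambda>i. (i div 2, odd i))) (nth rs)"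
        by (rule cyclic_decomp_eq)
          (auto simp: nth)
      then show "\<exists>x. cyclic_decomp {..<2 * length L} x (nth rs)" by - (rule exI)
    qed
    finally show ?thesis .
  qed
  moreover have "(\<exists>bs Bs. represents scale bs (diag_block_mat Bs) u \<and> (\<forall>B \<in> set Bs. \<exists>p. B = F p \<and> ?ok p))
      \<longleftrightarrow> (\<exists>L. (\<forall>p\<in>set L. ?ok p) \<and> (\<exists>bs. represents scale bs (diag_block_mat (map F L)) u))"
  proof (intro iffI; elim exE conjE)
    fix bs Bs assume rep: "represents scale bs (diag_block_mat Bs) u"
      and "\<forall>B \<in> set Bs. \<exists>p. B = F p \<and> ?ok p"
    then obtain g where g: "\<forall>B \<in> set Bs. B = F (g B) \<and> ?ok (g B)" by metis
    then have "map F (map g Bs) = Bs" by (simp add: map_idI)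
    then show "\<exists>L. (\<forall>p\<in>set L. ?ok p) \<and> (\<exists>bs. represents scale bs (diag_block_mat (map F L)) u)"
      using g rep by (intro exI[of _ "map g Bs"]) auto
  next
    fix L bs assume L: "\<forall>p\<in>set L. ?ok p" and rep: "represents scale bs (diag_block_mat (map F L)) u"
    have "\<exists>p. B = F p \<and> ?ok p" if "B \<in> set (map F L)" for B
    proof -
      from that obtain p where p: "B = F p" "p \<in> set L" unfolding set_map by (rule imageE)
      show ?thesis by (intro exI[of _ p] conjI p(1) bspec[OF L p(2)])
    qed
    then have "\<forall>B \<in> set (map F L). \<exists>p. B = F p \<and> ?ok p" by (rule ballI)
    with rep have "represents scale bs (diag_block_mat (map F L)) u \<and>
        (\<forall>B \<in> set (map F L). \<exists>p. B = F p \<and> ?ok p)" ..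
    then show "\<exists>bs Bs. represents scale bs (diag_block_mat Bs) u \<and> (\<forall>B \<in> set Bs. \<exists>p. B = F p \<and> ?ok p)"
      by - (rule exI, rule exI)
  qed
  ultimately show ?thesis unfolding F_pair ok paired_decomp_def by simp
qed

text \<open>Each invariant factor divides the minimal polynomial, so it is a power of t - d times a
  power of t + d and splits into two primary parts; equal invariant factors contribute equal
  parts.\<close>

lemma invariant_factors_imp_paired_decomp:
  assumes "d \<noteq> - d"
    and min: "is_minimal_poly scale u ([:- d, 1:] ^ m * [:d, 1:] ^ n)"
    and inv: "is_invariant_factors scale u s"
    and eq: "\<And>k. k \<ge> 1 \<Longrightarrow> s (2 * k - 1) = s (2 * k)"
  shows "paired_decomp d"
proof -
  let ?M = "[:- d, 1:] ^ m * [:- (- d), 1:] ^ n"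
  obtain N bs where N: "\<And>i. i > N \<Longrightarrow> s i = 1"
    and rep: "represents scale bs (diag_block_mat (map (\<lambda>i. companion_mat (s i)) [1..<N + 1])) u"
    and monic: "\<And>i. i \<ge> 1 \<Longrightarrow> monic (s i)"
    using inv unfolding is_invariant_factors_def by blast
  let ?rs = "map s [1..<N + 1]"
  have "\<exists>bs. represents scale bs (diag_block_mat (map companion_mat ?rs)) u"
    using rep by (auto simp: o_def)
  then obtain x0 where "cyclic_decomp {..<length ?rs} x0 (nth ?rs)"
    using represents_companion_iff[of ?rs] monic by auto
  then have "cyclic_decomp {..<N} x0 (nth ?rs)" by (simp del: upt_Suc)
  then have x0: "cyclic_decomp {..<N} x0 (\<lambda>i. s (Suc i))"
    by (rule cyclic_decomp_eq) (auto simp del: upt_Suc)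
  \<comment> \<open>\<open>N\<close> may be odd. Among \<open>2 * N\<close> factors, the additional
    ones being 1, none is left without its partner.\<close>
  obtain x where x: "cyclic_decomp {..<2 * N} x (\<lambda>i. s (Suc i))"
    using cyclic_decomp_extend[OF x0, of "{..<2 * N}"] N by auto
  have dvd: "s (Suc i) dvd ?M" if "i \<in> {..<2 * N}" for i
    using cyclic_decomp_ev_eq_0_iff[OF x, of ?M] min that unfolding is_minimal_poly_def
    by (auto simp: fun_eq_iff)
  have "\<exists>k l. s (Suc i) = [:- d, 1:] ^ k * [:- (- d), 1:] ^ l" if "i \<in> {..<2 * N}" for i
    by (rule monic_dvd_linear_powers[OF monic dvd[OF that]]) simp
  \<comment> \<open>The exponents are chosen as functions of the polynomial, not of its index, so
    equal invariant factors get equal exponents by construction.\<close>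
  then have "\<forall>r \<in> (\<lambda>i. s (Suc i)) ` {..<2 * N}. \<exists>k l. r = [:- d, 1:] ^ k * [:- (- d), 1:] ^ l"
    by (simp only: ball_simps) (rule ballI)
  then obtain f g where "\<forall>r \<in> (\<lambda>i. s (Suc i)) ` {..<2 * N}. r = [:- d, 1:] ^ f r * [:- (- d), 1:] ^ g r"
    unfolding bchoice_iff by blast
  then have fg: "s (Suc i) = [:- d, 1:] ^ f (s (Suc i)) * [:- (- d), 1:] ^ g (s (Suc i))"
    if "i \<in> {..<2 * N}" for i
    by (rule bspec) (use that in \<open>rule imageI\<close>)
  have cyc: "cyclic_decomp {..<2 * N} x
      (\<lambda>i. [:- d, 1:] ^ f (s (Suc i)) * [:- (- d), 1:] ^ g (s (Suc i)))"
    using x fg by (rule cyclic_decomp_eq)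
  obtain y where y: "cyclic_decomp ({..<2 * N} \<times> (UNIV :: bool set)) y
      (\<lambda>(i, b). if b then [:- d, 1:] ^ f (s (Suc i)) else [:- (- d), 1:] ^ g (s (Suc i)))"
    by (rule that[OF cyclic_decomp_split[OF cyc bezout_linear_powers[OF assms(1)]]]) simp
  \<comment> \<open>\<open>k\<close> numbers the pairs, \<open>b\<close> selects d or -d, and
    \<open>e\<close> is the member of the pair.\<close>
  let ?\<phi> = "\<lambda>((k, b), e). (2 * k + of_bool e, b)"
  have \<phi>: "bij_betw ?\<phi> (({..<N} \<times> (UNIV :: bool set)) \<times> (UNIV :: bool set)) ({..<2 * N} \<times> UNIV)"
    by (rule bij_betw_byWitness[where f' = "\<lambda>(i, b). ((i div 2, b), odd i)"]) auto
  let ?l = "\<lambda>(k, b). if b then d else - d"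
  let ?n = "\<lambda>(k, b). if b then f (s (Suc (2 * k))) else g (s (Suc (2 * k)))"
  have s_eq: "s (Suc (2 * k + of_bool e)) = s (Suc (2 * k))" for k e
    using eq[of "Suc k"] by simp
  have "cyclic_decomp (({..<N} \<times> (UNIV :: bool set)) \<times> (UNIV :: bool set)) (y \<circ> ?\<phi>)
      (\<lambda>(j, e). [:- ?l j, 1:] ^ ?n j)"
    using cyclic_decomp_reindex[OF y \<phi>]
    by (rule cyclic_decomp_eq) (auto simp: s_eq simp del: of_bool_eq)
  then show ?thesis by (rule paired_decompI) auto
qed

text \<open>The exponents for d and those for -d are sorted separately, and powers of equal rank are
  multiplied. By coprimality each product is the annihilator of one cyclic summand, and it occurs
  twice because every block does.\<close>

lemma paired_decomp_imp_invariant_factors: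
  assumes "d \<noteq> - d" "paired_decomp d"
  shows "(\<exists>m n. is_minimal_poly scale u ([:- d, 1:] ^ m * [:d, 1:] ^ n)) \<and>
     (\<exists>s. is_invariant_factors scale u s \<and> (\<forall>k \<ge> 1. s (2 * k - 1) = s (2 * k)))"
proof -
  obtain L :: "('a \<times> nat) list" and x where L: "\<And>l n. (l, n) \<in> set L \<Longrightarrow> l \<in> {d, - d}"
    and x: "cyclic_decomp ({..<length L} \<times> (UNIV :: bool set)) x
        (\<lambda>(k, b). [:- fst (L ! k), 1:] ^ snd (L ! k))"
    using assms(2) unfolding paired_decomp_def by blast
  define J where "J = (\<lambda>b. {j. j < length L \<and> fst (L ! j) = (if b then d else - d)})"
  define c where "c = (\<lambda>b. card (J b))"
  have "\<exists>\<phi>. bij_betw \<phi> {..<c b} (J b) \<and> (\<forall>i j. i \<le> j \<longrightarrow> j < c b \<longrightarrow> snd (L ! \<phi> j) \<le> snd (L ! \<phi> i))" for b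
    unfolding c_def by (rule ex_antimono_enumeration) (simp add: J_def)
  then obtain \<phi> where \<phi>: "\<And>b. bij_betw (\<phi> b) {..<c b} (J b)"
    and anti: "\<And>b i j. i \<le> j \<Longrightarrow> j < c b \<Longrightarrow> snd (L ! \<phi> b j) \<le> snd (L ! \<phi> b i)"
    by metis
  \<comment> \<open>Exponent 0 pads the shorter of the two sorted lists.\<close>
  define P where "P = (\<lambda>b k. if k < c b then snd (L ! \<phi> b k) else 0)"
  have P_anti: "P b j \<le> P b i" if "i \<le> j" for b i j
    using anti[of i j b] that by (auto simp: P_def)
  define M where "M = max (c True) (c False)"
  have P0: "P b k = 0" if "k \<ge> M" for b k
    using that by (cases b) (auto simp: P_def M_def)
  let ?K = "{(k, b). k < c b}"
  let ?\<psi> = "\<lambda>(k, b). \<phi> b k"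
  have \<phi>_J: "\<phi> b k \<in> J b" if "k < c b" for b k
    using bij_betw_apply[OF \<phi>] that by auto
  have "bij_betw ?\<psi> ?K {..<length L}"
  proof (rule bij_betwI')
    fix p q assume "p \<in> ?K" "q \<in> ?K"
    then obtain k b k' b' where pq: "p = (k, b)" "q = (k', b')" "k < c b" "k' < c b'" by auto
    have "b = b'" if "\<phi> b k = \<phi> b' k'"
      using \<phi>_J[OF pq(3)] \<phi>_J[OF pq(4)] that assms(1) by (auto simp: J_def split: if_splits)
    then show "?\<psi> p = ?\<psi> q \<longleftrightarrow> p = q"
      using pq inj_onD[OF bij_betw_imp_inj_on[OF \<phi>], of b k k'] by auto
  next
    fix p assume "p \<in> ?K"
    then show "?\<psi> p \<in> {..<length L}" using \<phi>_J by (auto simp: J_def)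
  next
    fix j assume j: "j \<in> {..<length L}"
    then have "fst (L ! j) \<in> {d, - d}" using L[of "fst (L ! j)" "snd (L ! j)"] by simp
    then have "j \<in> J True \<or> j \<in> J False" using j by (auto simp: J_def)
    then obtain b where "j \<in> J b" by blast
    then obtain k where "k < c b" "j = \<phi> b k"
      using \<phi>[of b] by (auto simp: bij_betw_def)
    then show "\<exists>p\<in>?K. j = ?\<psi> p" by auto
  qed
  then have bij: "bij_betw (map_prod ?\<psi> id) (?K \<times> (UNIV :: bool set)) ({..<length L} \<times> UNIV)"
    by (rule bij_betw_map_prod) (rule bij_betw_id)
  let ?lin = "\<lambda>b. [:- (if b then d else - d), 1:]"
  have cyc: "cyclic_decomp (?K \<times> (UNIV :: bool set)) (x \<circ> map_prod ?\<psi> id) (\<lambda>((k, b), e). ?lin b ^ P b k)"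
    using cyclic_decomp_reindex[OF x bij]
    by (rule cyclic_decomp_eq)
      (use \<phi>_J in \<open>auto simp: P_def J_def\<close>)
  have "c b \<le> M" for b by (cases b) (simp_all add: M_def)
  then have sub: "?K \<times> UNIV \<subseteq> ({..<M} \<times> UNIV) \<times> (UNIV :: bool set)"
    by (auto intro: less_le_trans)
  have triv: "(\<lambda>((k, b), e). ?lin b ^ P b k) i = 1"
    if i: "i \<in> ({..<M} \<times> UNIV) \<times> (UNIV :: bool set) - ?K \<times> UNIV" for i
  proof -
    obtain k b e where "i = ((k, b), e)" by (metis surj_pair)
    then show ?thesis using i by (simp add: P_def)
  qed
  have "\<exists>y. cyclic_decomp (({..<M} \<times> (UNIV :: bool set)) \<times> (UNIV :: bool set)) y
      (\<lambda>((k, b), e). ?lin b ^ P b k)"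
    by (rule cyclic_decomp_extend[OF cyc sub _ triv]) simp
  then obtain y where y: "cyclic_decomp (({..<M} \<times> (UNIV :: bool set)) \<times> (UNIV :: bool set)) y
      (\<lambda>((k, b), e). ?lin b ^ P b k)" ..
  \<comment> \<open>\<open>cyclic_decomp_merge\<close> combines along the last component; the choice
    between d and -d is moved there, and the copy number \<open>e\<close> stays part of the
    index.\<close>
  have swap: "bij_betw (\<lambda>((k, e), b). ((k, b), e)) (({..<M} \<times> (UNIV :: bool set)) \<times> (UNIV :: bool set))
      (({..<M} \<times> UNIV) \<times> UNIV)"
    by (rule bij_betw_byWitness[where f' = "\<lambda>((k, b), e). ((k, e), b)"]) auto
  have cyc: "cyclic_decomp (({..<M} \<times> (UNIV :: bool set)) \<times> (UNIV :: bool set)) (y \<circ> (\<lambda>((k, e), b). ((k, b), e)))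
      (\<lambda>(ke, b). if b then [:- d, 1:] ^ P True (fst ke) else [:- (- d), 1:] ^ P False (fst ke))"
    using cyclic_decomp_reindex[OF y swap]
    by (rule cyclic_decomp_eq) auto
  obtain z where z: "cyclic_decomp ({..<M} \<times> (UNIV :: bool set)) z
      (\<lambda>ke. [:- d, 1:] ^ P True (fst ke) * [:- (- d), 1:] ^ P False (fst ke))"
    by (rule that[OF cyclic_decomp_merge[OF cyc bezout_linear_powers[OF assms(1)]]])
  \<comment> \<open>Invariant factors are counted from 1, and \<open>(i - 1) div 2\<close> takes the
    same value at 2k - 1 and 2k.\<close>
  define s where "s = (\<lambda>i. [:- d, 1:] ^ P True ((i - 1) div 2) * [:- (- d), 1:] ^ P False ((i - 1) div 2))"
  have cyc: "cyclic_decomp {..<2 * M} (z \<circ> (\<lambda>i. (i div 2, odd i))) (\<lambda>i. s (Suc i))"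
    using cyclic_decomp_reindex[OF z bij_betw_div_mod_2]
    by (rule cyclic_decomp_eq) (auto simp: s_def)
  have monic_s: "monic (s i)" for i
    unfolding s_def by (intro monic_mult monic_linear_power)
  have s_dvd: "s j dvd s i" if "i \<le> j" for i j
    unfolding s_def using that
    by (intro mult_dvd_mono le_imp_power_dvd P_anti div_le_mono diff_le_mono)
  have s_1: "s i = 1" if "i > 2 * M" for i
    using that P0[of "(i - 1) div 2"] by (simp add: s_def)
  have "is_minimal_poly scale u (s 1)"
    unfolding is_minimal_poly_def
  proof (intro conjI allI impI monic_s)
    have "\<forall>v. ev (s 1) v = 0"
      unfolding cyclic_decomp_ev_eq_0_iff[OF cyc] using s_dvd by auto
    then show "ev (s 1) = (\<lambda>_. 0)" by auto
    fix r assume "ev r = (\<lambda>_. 0)"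
    then have *: "\<forall>i\<in>{..<2 * M}. s (Suc i) dvd r"
      using cyclic_decomp_ev_eq_0_iff[OF cyc, of r] by simp
    \<comment> \<open>If \<open>M = 0\<close> there are no blocks; the space is zero and its minimal
      polynomial is 1.\<close>
    show "s 1 dvd r"
      using * s_1[of 1] by (cases "M = 0") auto
  qed
  then have "\<exists>m n. is_minimal_poly scale u ([:- d, 1:] ^ m * [:d, 1:] ^ n)"
    unfolding s_def by auto
  moreover have "is_invariant_factors scale u s"
    unfolding is_invariant_factors_def
  proof (intro conjI allI impI monic_s exI[of _ "2 * M"])
    let ?rs = "map s [1..<2 * M + 1]"
    have monic_rs: "monic r" if "r \<in> set ?rs" for r
      using that monic_s unfolding set_map by blast
    have "cyclic_decomp {..<2 * M} (z \<circ> (\<lambda>i. (i div 2, odd i))) (nth ?rs)"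
      using cyc by (rule cyclic_decomp_eq) (auto simp del: upt_Suc)
    then have "\<exists>x. cyclic_decomp {..<2 * M} x (nth ?rs)" by - (rule exI)
    then have "\<exists>x. cyclic_decomp {..<length ?rs} x (nth ?rs)" by (simp del: upt_Suc)
    then have "\<exists>bs. represents scale bs (diag_block_mat (map companion_mat ?rs)) u"
      by (rule iffD2[OF represents_companion_iff, rotated]) (rule monic_rs)
    then show "\<exists>bs. represents scale bs (diag_block_mat (map (\<lambda>i. companion_mat (s i)) [1..<2 * M + 1])) u"
      by (simp add: o_def del: upt_Suc)
  qed (use s_dvd s_1 in auto)
  moreover have "s (2 * k - 1) = s (2 * k)" if "k \<ge> 1" for k
  proof -
    have "(2 * k - 1 - 1) div 2 = (2 * k - 1) div 2" using that by (cases k) simp_all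
    then show ?thesis by (simp only: s_def)
  qed
  ultimately show ?thesis by blast
qed

lemma vs_endoI: "Vector_Spaces.linear scale scale a \<Longrightarrow> vs_endo scale a"
  by (simp add: vs_endo_def vs_endo_axioms_def vector_space_axioms)

end

section \<open>Quotients and eigenvalues\<close>

context vs_endo
begin

text \<open>If m = c + t m', then m(u) = 0 reads u m'(u) = -c, so -m'(u)/c inverts u. It matters
  that the inverse is a polynomial in \<open>u\<close>: it commutes with \<open>u\<close> and
  preserves the F[t]-submodules.\<close>

lemma ex_inverse_poly:
  assumes "\<And>v. ev m v = 0" "poly m 0 \<noteq> 0"
  shows "\<exists>g. \<forall>v. u (ev g v) = v"
proof -
  obtain c m' where m: "m = pCons c m'" by (rule pCons_cases)
  then have c: "c \<noteq> 0" using assms(2) by simp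
  have "u (ev (Polynomial.smult (- inverse c) m') v) = v" for v
  proof -
    have "u (ev m' v) = - (c *s v)"
      using assms(1)[of v] unfolding m ev_pCons by (metis add_eq_0_iff)
    then show ?thesis using c by (simp add: ev_smult ev_minus u_scale u_minus)
  qed
  then show ?thesis by blast
qed

lemma bij_u:
  assumes "\<And>v. u (ev g v) = v"
  shows "bij u"
  by (intro o_bij[of "ev g"]) (simp_all add: fun_eq_iff assms ev_u)

text \<open>Universal property of a direct sum of cyclic modules. The target is \<open>V\<close>
  with t acting as \<open>w\<close>; the choice w = d^2 u^-1 produces maps that twist
  \<open>u\<close> in the required way.\<close>

lemma cyclic_decomp_hom:
  assumes cyc: "cyclic_decomp I x r" and w: "vs_endo scale w"
    and y: "\<And>i. i \<in> I \<Longrightarrow> poly_endo scale (r i) w (y i) = 0"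
  shows "\<exists>a. Vector_Spaces.linear scale scale a \<and> (\<forall>v. a (u v) = w (a v)) \<and> (\<forall>i\<in>I. a (x i) = y i)"
proof -
  interpret W: vs_endo scale w by (rule w)
  define e where "e = (\<lambda>f. \<Sum>i\<in>I. ev (f i) (x i))"
  define h where "h = (\<lambda>f. \<Sum>i\<in>I. W.ev (f i) (y i))"
  have fin: "finite I" using cyc by (rule cyclic_decomp_finite)
  have e_diff: "e (\<lambda>i. f i - g i) = e f - e g" for f g
    by (simp add: e_def ev_diff sum_subtractf)
  have e_add: "e (\<lambda>i. f i + g i) = e f + e g" and h_add: "h (\<lambda>i. f i + g i) = h f + h g" for f g
    by (simp_all add: e_def h_def ev_add W.ev_add sum.distrib)
  have e_scale: "e (\<lambda>i. Polynomial.smult c (f i)) = c *s e f"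
    and h_scale: "h (\<lambda>i. Polynomial.smult c (f i)) = c *s h f" for c f
    by (simp_all add: e_def h_def ev_smult W.ev_smult scale_sum_right)
  have e_u: "e (\<lambda>i. pCons 0 (f i)) = u (e f)" and h_w: "h (\<lambda>i. pCons 0 (f i)) = w (h f)" for f
    by (simp_all add: e_def h_def u_sum W.u_sum)
  have well: "h f = h g" if "e f = e g" for f g
  proof -
    have "(\<Sum>i\<in>I. ev (f i - g i) (x i)) = 0" using that e_diff[of f g] by (simp add: e_def)
    then have "W.ev (f i - g i) (y i) = 0" if "i \<in> I" for i
      using W.ev_dvd[OF cyclic_decomp_dvd[OF cyc _ that] y[OF that], of "\<lambda>i. f i - g i"] by simp
    then show ?thesis by (simp add: h_def W.ev_diff)
  qed
  \<comment> \<open>The coefficients of a vector are not unique; \<open>well\<close> makes the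
    choice immaterial.\<close>
  define a where "a = (\<lambda>v. h (SOME f. v = e f))"
  have a_e: "a (e f) = h f" for f
    unfolding a_def by (rule well) (metis (mono_tags, lifting) someI_ex)
  have ex_e: "\<exists>f. v = e f" for v
    using cyclic_decomp_span[OF cyc, of v] by (simp only: e_def)
  have "a (v + v') = a v + a v'" for v v'
  proof -
    obtain f g where "v = e f" "v' = e g" using ex_e by metis
    then show ?thesis by (simp add: a_e h_add flip: e_add)
  qed
  moreover have "a (c *s v) = c *s a v" and "a (u v) = w (a v)" for c v
  proof -
    obtain f where "v = e f" using ex_e by metis
    then show "a (c *s v) = c *s a v" "a (u v) = w (a v)"
      by (simp_all add: a_e h_scale h_w flip: e_scale e_u)
  qed
  moreover have "a (x i) = y i" if "i \<in> I" for i
  proof -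
    let ?f = "\<lambda>j. if j = i then 1 else 0"
    have "(\<Sum>j\<in>I. ev (?f j) (x j)) = (\<Sum>j\<in>I. if j = i then x i else 0)"
      "(\<Sum>j\<in>I. W.ev (?f j) (y j)) = (\<Sum>j\<in>I. if j = i then y i else 0)"
      by (auto intro!: sum.cong)
    then have "e ?f = x i" "h ?f = y i" using fin that by (simp_all add: e_def h_def)
    then show ?thesis using a_e[of ?f] by simp
  qed
  ultimately show ?thesis
    unfolding Vector_Spaces.linear_iff using vector_space_axioms by blast
qed

text \<open>\<open>b\<close> is determined by \<open>u\<close> and \<open>a\<close> as u^-1 a, so it
  can be eliminated: given a^2 = c, the condition b^2 = c/d^2 becomes u a u = d^2 a.\<close>

lemma pq_quotient_iff:
  assumes c: "c \<noteq> 0" and d: "d \<noteq> 0"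
  shows "pq_quotient scale [:- c, 0, 1:] [:- (c / d ^ 2), 0, 1:] u \<longleftrightarrow> bij u \<and>
    (\<exists>a. Vector_Spaces.linear scale scale a \<and> (\<forall>v. a (a v) = c *s v) \<and> (\<forall>v. u (a (u v)) = d ^ 2 *s a v))"
    (is "?L \<longleftrightarrow> ?R")
proof -
  have quad: "poly_endo scale [:- k, 0, 1:] a = (\<lambda>_. 0) \<longleftrightarrow> (\<forall>v. a (a v) = k *s v)"
    if "Vector_Spaces.linear scale scale a" for a k
  proof -
    interpret A: vs_endo scale a by (rule vs_endoI) (rule that)
    show ?thesis by (auto simp: fun_eq_iff)
  qed
  have bij_sq: "bij a" if "Vector_Spaces.linear scale scale a" "\<And>v. a (a v) = k *s v" "k \<noteq> 0" for a k
  proof -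
    interpret A: vs_endo scale a by (rule vs_endoI) (rule that)
    have "a (inverse k *s a v) = v" "inverse k *s a (a v) = v" for v
      using that(2,3) by (simp_all add: A.u_scale)
    then show ?thesis by (intro o_bij[of "\<lambda>v. inverse k *s a v"]) (simp_all add: fun_eq_iff)
  qed
  show ?thesis
  proof
    assume ?L
    then obtain a b where a: "Vector_Spaces.linear scale scale a" "bij a"
        and b: "Vector_Spaces.linear scale scale b" "bij b"
        and ann: "poly_endo scale [:- c, 0, 1:] a = (\<lambda>_. 0)"
          "poly_endo scale [:- (c / d ^ 2), 0, 1:] b = (\<lambda>_. 0)"
        and u: "u = a \<circ> inv_into UNIV b"
      unfolding pq_quotient_def is_automorphism_def by blast
    have aa: "a (a v) = c *s v" and bb: "b (b v) = (c / d ^ 2) *s v" for v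
      using ann by (simp_all only: quad[OF a(1)] quad[OF b(1)])
    have ub: "u (b v) = a v" for v
      using b(2) by (simp add: u bij_is_inj)
    have "bij u" unfolding u using a(2) b(2) by (intro bij_comp bij_imp_bij_inv)
    moreover have "u (a (u v)) = d ^ 2 *s a v" for v
    proof -
      obtain z where z: "v = b z" using surjD[OF bij_is_surj[OF b(2)], of v] by blast
      \<comment> \<open>With v = b z one has u v = a z, hence u a u v = u a^2 z = c u z, while a v =
        u b v = u b^2 z = (c/d^2) u z.\<close>
      have "c *s u z = d ^ 2 *s u ((c / d ^ 2) *s z)" using d by (simp add: u_scale)
      also have "\<dots> = d ^ 2 *s a v" by (simp only: bb[symmetric] ub z)
      finally show ?thesis by (simp add: z ub aa u_scale)
    qed
    ultimately show ?R using a(1) aa by blast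
  next
    assume ?R
    then obtain a where bij: "bij u" and a: "Vector_Spaces.linear scale scale a" "\<And>v. a (a v) = c *s v"
      and ua: "\<And>v. u (a (u v)) = d ^ 2 *s a v" by blast
    interpret A: vs_endo scale a by (rule vs_endoI) (rule a)
    define b where "b = (\<lambda>v. inv_into UNIV u (a v))"
    have ub: "u (b v) = a v" for v
      using bij by (simp add: b_def bij_is_surj surj_f_inv_f)
    have u_inj: "x = y" if "u x = u y" for x y
      using injD[OF bij_is_inj[OF bij] that] .
    have "b (x + y) = b x + b y" for x y
      by (rule u_inj) (simp add: ub u_add A.u_add)
    moreover have "b (k *s x) = k *s b x" for k x
      by (rule u_inj) (simp add: ub u_scale A.u_scale)
    ultimately have lin_b: "Vector_Spaces.linear scale scale b"
      by (simp add: Vector_Spaces.linear_iff vector_space_axioms)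
    have bb: "b (b v) = (c / d ^ 2) *s v" for v
    proof (rule u_inj)
      have "d ^ 2 *s a (b v) = c *s u v"
        using ua[of "b v"] by (simp add: ub a(2) u_scale)
      then have "inverse (d ^ 2) *s (d ^ 2 *s a (b v)) = inverse (d ^ 2) *s (c *s u v)" by simp
      then show "u (b (b v)) = u ((c / d ^ 2) *s v)"
        using d by (simp add: ub u_scale field_simps)
    qed
    have bij_b: "bij b" by (rule bij_sq[OF lin_b bb]) (use c d in simp)
    have "u = a \<circ> inv_into UNIV b"
    proof
      fix v
      have "u (b (inv_into UNIV b v)) = a (inv_into UNIV b v)" by (rule ub)
      then show "u v = (a \<circ> inv_into UNIV b) v" using bij_b by (simp add: bij_is_surj surj_f_inv_f)
    qed
    moreover have "bij a" by (rule bij_sq[OF a c])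
    ultimately show ?L
      unfolding pq_quotient_def is_automorphism_def
      using a lin_b bb bij_b quad[OF a(1)] quad[OF lin_b] by blast
  qed
qed

lemma paired_decomp_imp_conjugate:
  assumes d: "d \<noteq> 0" and pd: "paired_decomp d"
  shows "bij u" (is ?A)
    and "\<exists>a. Vector_Spaces.linear scale scale a \<and> (\<forall>v. a (a v) = c *s v) \<and> (\<forall>v. u (a (u v)) = d ^ 2 *s a v)" (is ?B)
    and "\<exists>N. \<forall>v. ev ([:- d, 1:] ^ N * [:d, 1:] ^ N) v = 0" (is ?C)
proof -
  obtain L :: "('a \<times> nat) list" and x where L: "\<And>l n. (l, n) \<in> set L \<Longrightarrow> l \<in> {d, - d}"
    and x: "cyclic_decomp ({..<length L} \<times> (UNIV :: bool set)) x
        (\<lambda>(k, b). [:- fst (L ! k), 1:] ^ snd (L ! k))"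
    using pd unfolding paired_decomp_def by blast
  have Lk: "fst (L ! k) = d \<or> fst (L ! k) = - d" if "k < length L" for k
    using L[of "fst (L ! k)" "snd (L ! k)"] that by simp
  define N where "N = (\<Sum>k<length L. snd (L ! k))"
  have nN: "snd (L ! k) \<le> N" if "k < length L" for k
    unfolding N_def by (rule member_le_sum) (use that in auto)
  define m where "m = [:- d, 1:] ^ N * [:d, 1:] ^ N"
  have "[:- fst (L ! k), 1:] ^ snd (L ! k) dvd m" if "k < length L" for k
    using Lk[OF that] le_imp_power_dvd[OF nN[OF that]]
    by (auto simp: m_def intro: dvd_mult dvd_mult2)
  then have ann: "ev m v = 0" for v
    using cyclic_decomp_ev_eq_0_iff[OF x, of m] by auto
  then show ?C unfolding m_def by blast
  have "poly m 0 \<noteq> 0" using d by (simp add: m_def)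
  then obtain g where g: "\<And>v. u (ev g v) = v" using ex_inverse_poly[OF ann] by blast
  show bij: ?A by (rule bij_u[OF g])
  \<comment> \<open>This is d^2 u^-1, written as a polynomial in \<open>u\<close>.\<close>
  define w where "w = ev (Polynomial.smult (d ^ 2) g)"
  have uw: "u (w v) = d ^ 2 *s v" for v
    by (simp add: w_def g u_scale ev_smult)
  interpret W: vs_endo scale w
    by (rule vs_endoI) (auto simp: Vector_Spaces.linear_iff vector_space_axioms w_def ev_vadd ev_vscale)
  have u_pow_inj: "v = 0" if "(u ^^ n) v = 0" for n v
    using that
  proof (induction n)
    case (Suc n)
    then have "u ((u ^^ n) v) = u 0" by simp
    then have "(u ^^ n) v = 0" by (rule injD[OF bij_is_inj[OF bij]])
    then show ?case by (rule Suc.IH)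
  qed simp
  have pow_scale: "(u ^^ n) (k *s v) = k *s (u ^^ n) v" for n k v
    by (induction n) (auto simp: u_scale)
  \<comment> \<open>For l^2 = d^2 one has u (w - l) = d^2 - l u = -l (u - l). Iterated, this shows
    that whatever (u - l)^n kills is killed by (w - l)^n, because \<open>u\<close> is
    injective.\<close>
  have W_lin: "(u ^^ n) (W.ev ([:- l, 1:] ^ n) v) = (- l) ^ n *s ev ([:- l, 1:] ^ n) v"
    if l: "l ^ 2 = d ^ 2" for l n v
  proof (induction n)
    case (Suc n)
    let ?y = "W.ev ([:- l, 1:] ^ n) v"
    have lin: "W.ev [:- l, 1:] ?y = w ?y - l *s ?y" "ev [:- l, 1:] ?y = u ?y - l *s ?y"
      by simp_all
    have "u (W.ev [:- l, 1:] ?y) = l ^ 2 *s ?y - l *s u ?y"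
      by (simp add: lin u_diff u_scale uw l)
    also have "\<dots> = (- l) *s ev [:- l, 1:] ?y"
      by (simp add: lin scale_right_diff_distrib power2_eq_square)
    finally have "u (W.ev [:- l, 1:] ?y) = (- l) *s ev [:- l, 1:] ?y" .
    then have "(u ^^ Suc n) (W.ev ([:- l, 1:] ^ Suc n) v) = (u ^^ n) ((- l) *s ev [:- l, 1:] ?y)"
      unfolding funpow_Suc_right o_def power_Suc W.ev_mult by (rule arg_cong)
    also have "\<dots> = (- l) *s ev [:- l, 1:] ((- l) ^ n *s ev ([:- l, 1:] ^ n) v)"
      by (simp only: pow_scale pow_ev Suc.IH)
    also have "\<dots> = (- l) ^ Suc n *s ev ([:- l, 1:] ^ Suc n) v"
      by (simp only: ev_vscale ev_mult power_Suc scale_scale)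
    finally show ?case .
  qed simp
  \<comment> \<open>On each pair \<open>a\<close> exchanges the two generators, with the factor
    \<open>c\<close> on one side only, so applying it twice multiplies both by
    \<open>c\<close>.\<close>
  define y where "y = (\<lambda>(k, b). if b then x (k, False) else c *s x (k, True))"
  have "\<exists>a. Vector_Spaces.linear scale scale a \<and> (\<forall>v. a (u v) = w (a v)) \<and>
      (\<forall>i\<in>{..<length L} \<times> (UNIV :: bool set). a (x i) = y i)"
  proof (rule cyclic_decomp_hom[OF x W.vs_endo_axioms])
    fix i assume "i \<in> {..<length L} \<times> (UNIV :: bool set)"
    then obtain k b where i: "i = (k, b)" "k < length L" by auto
    let ?r = "[:- fst (L ! k), 1:] ^ snd (L ! k)"
    have "ev ?r (x (k, b')) = 0" for b'
      using cyclic_decomp_ann[OF x, of "(k, b')"] i(2) by simp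
    then have "ev ?r (y i) = 0" by (simp add: i y_def ev_vscale)
    moreover have "fst (L ! k) ^ 2 = d ^ 2" using Lk[OF i(2)] by auto
    ultimately have "(u ^^ snd (L ! k)) (W.ev ?r (y i)) = 0" by (simp add: W_lin)
    then have "W.ev ?r (y i) = 0" by (rule u_pow_inj)
    then show "poly_endo scale (case i of (k, b) \<Rightarrow> [:- fst (L ! k), 1:] ^ snd (L ! k)) w (y i) = 0"
      by (simp add: i(1))
  qed
  then obtain a where a: "Vector_Spaces.linear scale scale a" and au: "\<And>v. a (u v) = w (a v)"
    and ax: "\<And>i. i \<in> {..<length L} \<times> (UNIV :: bool set) \<Longrightarrow> a (x i) = y i" by blast
  interpret A: vs_endo scale a by (rule vs_endoI) (rule a)
  \<comment> \<open>The relation a u = w a with \<open>u\<close> and \<open>w\<close> exchanged.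
    Together they make a^2 commute with \<open>u\<close>, so a^2 = c has to be checked on the
    generators only.\<close>
  have aw: "a (w v) = u (a v)" for v
  proof -
    have "u (a (u (w v))) = u (w (a (w v)))" by (simp only: au)
    then have "d ^ 2 *s u (a v) = d ^ 2 *s a (w v)" by (simp add: uw A.u_scale u_scale)
    then show ?thesis using d by (simp add: scale_left_imp_eq)
  qed
  have "a (a (ev f v)) = ev f (a (a v))" for f v
    by (induction f) (auto simp: A.u_add A.u_scale au aw)
  moreover have "a (a (x i)) = c *s x i" if i: "i \<in> {..<length L} \<times> (UNIV :: bool set)" for i
  proof -
    obtain k b where kb: "i = (k, b)" by force
    have "a (x (k, b')) = y (k, b')" for b' using ax[of "(k, b')"] i kb by simp
    then show ?thesis by (cases b) (simp_all add: kb y_def A.u_scale)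
  qed
  ultimately have "a (a v) = c *s v" for v
  proof -
    assume comm: "\<And>f v. a (a (ev f v)) = ev f (a (a v))"
      and gen: "\<And>i. i \<in> {..<length L} \<times> (UNIV :: bool set) \<Longrightarrow> a (a (x i)) = c *s x i"
    obtain f where "v = (\<Sum>i\<in>{..<length L} \<times> UNIV. ev (f i) (x i))"
      using cyclic_decomp_span[OF x] by blast
    then show ?thesis
      by (simp add: A.u_sum comm gen ev_vscale scale_sum_right cong: sum.cong_simp)
  qed
  moreover have "u (a (u v)) = d ^ 2 *s a v" for v by (simp add: au uw)
  ultimately show ?B using a by blast
qed

text \<open>An element of the dual of the scalar extension of \<open>V\<close>, viewed as an
  F-linear map into the closure. Eigenvectors over the closure can thus be handled while the space
  stays \<open>V\<close>.\<close>

definition semilin :: "('v \<Rightarrow> 'a alg_closure) \<Rightarrow> bool" where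
  "semilin \<phi> \<longleftrightarrow> (\<forall>x y. \<phi> (x + y) = \<phi> x + \<phi> y) \<and> (\<forall>c x. \<phi> (c *s x) = to_ac c * \<phi> x)"

lemma semilin_add: "semilin \<phi> \<Longrightarrow> \<phi> (x + y) = \<phi> x + \<phi> y"
  and semilin_scale: "semilin \<phi> \<Longrightarrow> \<phi> (c *s x) = to_ac c * \<phi> x"
  by (simp_all add: semilin_def)

lemma semilin_zero: "semilin \<phi> \<Longrightarrow> \<phi> 0 = 0"
  using semilin_scale[of \<phi> 0 0] by simp

lemma semilin_diff: "semilin \<phi> \<Longrightarrow> \<phi> (x - y) = \<phi> x - \<phi> y"
  using semilin_add[of \<phi> "x - y" y] by simp

lemma semilin_sum: "semilin \<phi> \<Longrightarrow> \<phi> (\<Sum>i\<in>I. x i) = (\<Sum>i\<in>I. \<phi> (x i))"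
  by (induction I rule: infinite_finite_induct) (auto simp: semilin_add semilin_zero)

lemma semilin_extend:
  assumes "basis_family K b"
  shows "\<exists>\<phi>. semilin \<phi> \<and> (\<forall>k\<in>K. \<phi> (b k) = z k)"
proof -
  define coord where "coord = (\<lambda>v. SOME a. v = (\<Sum>k\<in>K. a k *s b k))"
  have coord: "v = (\<Sum>k\<in>K. coord v k *s b k)" for v
    unfolding coord_def using basis_family_span[OF assms, of v] by (rule someI_ex)
  have uniq: "coord v k = a k" if v: "v = (\<Sum>k\<in>K. a k *s b k)" and k: "k \<in> K" for v a k
  proof -
    have "(\<Sum>k\<in>K. (coord v k - a k) *s b k) = 0"
      using coord[of v] v by (simp add: scale_left_diff_distrib sum_subtractf)
    from basis_familyD[OF assms this k] show ?thesis by simp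
  qed
  define \<phi> where "\<phi> = (\<lambda>v. \<Sum>k\<in>K. to_ac (coord v k) * z k)"
  have \<phi>_sum: "\<phi> v = (\<Sum>k\<in>K. to_ac (a k) * z k)" if "v = (\<Sum>k\<in>K. a k *s b k)" for v a
    unfolding \<phi>_def by (rule sum.cong) (simp_all add: uniq[OF that])
  have "\<phi> (v + v') = \<phi> v + \<phi> v'" for v v'
  proof -
    have "v + v' = (\<Sum>k\<in>K. (coord v k + coord v' k) *s b k)"
      by (subst (1) coord[of v], subst (1) coord[of v']) (simp add: scale_left_distrib sum.distrib)
    from \<phi>_sum[OF this] show ?thesis by (simp add: \<phi>_def distrib_right sum.distrib)
  qed
  moreover have "\<phi> (c *s v) = to_ac c * \<phi> v" for c v
  proof -
    have "c *s v = (\<Sum>k\<in>K. (c * coord v k) *s b k)"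
      by (subst (1) coord[of v]) (simp add: scale_sum_right)
    from \<phi>_sum[OF this] show ?thesis by (simp add: \<phi>_def sum_distrib_left mult.assoc)
  qed
  moreover have "\<phi> (b k) = z k" if k: "k \<in> K" for k
  proof -
    have fin: "finite K" using assms by (rule basis_family_finite)
    have "b k = (\<Sum>j\<in>K. if j = k then b j else 0)" using fin k by simp
    also have "\<dots> = (\<Sum>j\<in>K. (if j = k then 1 else 0) *s b j)" by (rule sum.cong) auto
    finally have "\<phi> (b k) = (\<Sum>j\<in>K. to_ac (if j = k then 1 else 0) * z j)" by (rule \<phi>_sum)
    also have "\<dots> = (\<Sum>j\<in>K. if j = k then z j else 0)" by (rule sum.cong) auto
    finally show ?thesis using fin k by simp
  qed
  ultimately show ?thesis unfolding semilin_def by blast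
qed

text \<open>A semilinear functional corresponds to the vector of its values on the basis, and pulling it
  back along \<open>u\<close> corresponds to applying the transpose of the matrix.\<close>

lemma eigenvalue_iff_semilin:
  assumes rep: "represents scale bs A u"
  shows "eigenvalue (map_mat to_ac A) \<gamma> \<longleftrightarrow>
    (\<exists>\<phi>. semilin \<phi> \<and> (\<exists>v. \<phi> v \<noteq> 0) \<and> (\<forall>v. \<phi> (u v) = \<gamma> * \<phi> v))"
proof -
  let ?n = "length bs" and ?B = "map_mat to_ac A"
  have bf: "basis_family {..<?n} (nth bs)" and A: "A \<in> carrier_mat ?n ?n"
    and ub: "\<And>j. j < ?n \<Longrightarrow> u (bs ! j) = (\<Sum>i<?n. (A $$ (i, j)) *s bs ! i)"
    using rep unfolding represents_def ordered_basis_iff by blast+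
  have B: "?B \<in> carrier_mat ?n ?n" "transpose_mat ?B \<in> carrier_mat ?n ?n" using A by auto
  have mult: "(transpose_mat ?B *\<^sub>v z) $ j = (\<Sum>i<?n. to_ac (A $$ (i, j)) * z $ i)"
    if "z \<in> carrier_vec ?n" "j < ?n" for z j
    using that A by (auto simp: scalar_prod_def lessThan_atLeast0 intro!: sum.cong)
  have \<phi>_ub: "\<phi> (u (bs ! j)) = (\<Sum>i<?n. to_ac (A $$ (i, j)) * \<phi> (bs ! i))"
    if "semilin \<phi>" "j < ?n" for \<phi> j
    using that by (simp add: ub semilin_sum semilin_scale)
  have "eigenvalue ?B \<gamma> \<longleftrightarrow> eigenvalue (transpose_mat ?B) \<gamma>"
    unfolding eigenvalue_root_char_poly[OF B(1)] eigenvalue_root_char_poly[OF B(2)]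
      char_poly_transpose_mat[OF B(1)] ..
  also have "\<dots> \<longleftrightarrow> (\<exists>\<phi>. semilin \<phi> \<and> (\<exists>v. \<phi> v \<noteq> 0) \<and> (\<forall>v. \<phi> (u v) = \<gamma> * \<phi> v))"
  proof
    assume "eigenvalue (transpose_mat ?B) \<gamma>"
    then obtain z where z: "z \<in> carrier_vec ?n" "z \<noteq> 0\<^sub>v ?n" "transpose_mat ?B *\<^sub>v z = \<gamma> \<cdot>\<^sub>v z"
      using B(2) unfolding eigenvalue_def eigenvector_def by auto
    obtain \<phi> where \<phi>: "semilin \<phi>" "\<And>i. i < ?n \<Longrightarrow> \<phi> (bs ! i) = z $ i"
      using semilin_extend[OF bf, of "\<lambda>i. z $ i"] by auto
    obtain i where i: "i < ?n" "z $ i \<noteq> 0"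
      using z(1,2) by (metis carrier_vecD eq_vecI index_zero_vec(1,2))
    have \<phi>u: "\<phi> (u (bs ! j)) = \<gamma> * \<phi> (bs ! j)" if j: "j < ?n" for j
    proof -
      have "\<phi> (u (bs ! j)) = (transpose_mat ?B *\<^sub>v z) $ j"
        unfolding mult[OF z(1) j] \<phi>_ub[OF \<phi>(1) j] by (rule sum.cong) (simp_all add: \<phi>(2))
      then show ?thesis unfolding z(3) using j z(1) by (simp add: \<phi>(2))
    qed
    have "\<phi> (u v) = \<gamma> * \<phi> v" for v
    proof -
      obtain a where v: "v = (\<Sum>k<?n. a k *s bs ! k)" using basis_family_span[OF bf] by blast
      show ?thesis unfolding v
        by (simp add: u_sum u_scale semilin_sum[OF \<phi>(1)] semilin_scale[OF \<phi>(1)] \<phi>u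
            sum_distrib_left mult.left_commute cong: sum.cong_simp)
    qed
    then show "\<exists>\<phi>. semilin \<phi> \<and> (\<exists>v. \<phi> v \<noteq> 0) \<and> (\<forall>v. \<phi> (u v) = \<gamma> * \<phi> v)"
      using \<phi> i by metis
  next
    assume "\<exists>\<phi>. semilin \<phi> \<and> (\<exists>v. \<phi> v \<noteq> 0) \<and> (\<forall>v. \<phi> (u v) = \<gamma> * \<phi> v)"
    then obtain \<phi> v where \<phi>: "semilin \<phi>" "\<phi> v \<noteq> 0" "\<And>v. \<phi> (u v) = \<gamma> * \<phi> v" by blast
    let ?z = "vec ?n (\<lambda>i. \<phi> (bs ! i))"
    obtain a where v: "v = (\<Sum>k<?n. a k *s bs ! k)" using basis_family_span[OF bf] by blast
    have "?z \<noteq> 0\<^sub>v ?n"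
    proof
      assume "?z = 0\<^sub>v ?n"
      then have "\<phi> (bs ! i) = 0" if "i < ?n" for i
        using that by (metis index_vec index_zero_vec(1))
      then have "\<phi> v = 0" unfolding v by (simp add: semilin_sum[OF \<phi>(1)] semilin_scale[OF \<phi>(1)])
      then show False using \<phi>(2) by simp
    qed
    moreover have "transpose_mat ?B *\<^sub>v ?z = \<gamma> \<cdot>\<^sub>v ?z"
    proof (rule eq_vecI)
      fix j assume "j < dim_vec (\<gamma> \<cdot>\<^sub>v ?z)"
      then have j: "j < ?n" by simp
      have "(transpose_mat ?B *\<^sub>v ?z) $ j = \<phi> (u (bs ! j))"
        unfolding \<phi>_ub[OF \<phi>(1) j] by (subst mult[OF _ j]) (auto intro!: sum.cong)
      then show "(transpose_mat ?B *\<^sub>v ?z) $ j = (\<gamma> \<cdot>\<^sub>v ?z) $ j" using j by (simp add: \<phi>(3))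
    qed (use A in auto)
    ultimately show "eigenvalue (transpose_mat ?B) \<gamma>"
      unfolding eigenvalue_def eigenvector_def by (intro exI[of _ ?z]) (use A in auto)
  qed
  finally show ?thesis .
qed

lemma semilin_eigen_linear_power:
  assumes "semilin \<phi>" "\<And>v. \<phi> (u v) = \<gamma> * \<phi> v"
  shows "\<phi> (ev ([:- l, 1:] ^ n) v) = (\<gamma> - to_ac l) ^ n * \<phi> v"
proof (induction n)
  case (Suc n)
  have "\<phi> (ev [:- l, 1:] w) = (\<gamma> - to_ac l) * \<phi> w" for w
    by (simp add: semilin_diff[OF assms(1)] semilin_scale[OF assms(1)] assms(2) left_diff_distrib)
  then show ?case by (simp only: power_Suc ev_mult Suc.IH mult.assoc)
qed simp

text \<open>An eigenfunctional for x turns u - d and u + d into the scalars x - d and x + d, whose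
  powers must then multiply to 0.\<close>

lemma ac_eigenvalues_subset:
  assumes "\<And>v. ev ([:- d, 1:] ^ N * [:d, 1:] ^ N) v = 0"
  shows "ac_eigenvalues scale u \<subseteq> {to_ac d, - to_ac d}"
proof
  fix x assume "x \<in> ac_eigenvalues scale u"
  then obtain bs A where rep: "represents scale bs A u" and ev: "eigenvalue (map_mat to_ac A) x"
    unfolding ac_eigenvalues_def by blast
  obtain \<phi> v where \<phi>: "semilin \<phi>" "\<phi> v \<noteq> 0" "\<And>v. \<phi> (u v) = x * \<phi> v"
    using ev unfolding eigenvalue_iff_semilin[OF rep] by blast
  have "0 = \<phi> (ev ([:- d, 1:] ^ N * [:- (- d), 1:] ^ N) v)"
    using assms semilin_zero[OF \<phi>(1)] by simp
  also have "\<dots> = (x - to_ac d) ^ N * ((x - to_ac (- d)) ^ N * \<phi> v)"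
    by (simp only: ev_mult semilin_eigen_linear_power[OF \<phi>(1,3)])
  finally have "x - to_ac d = 0 \<or> x + to_ac d = 0" using \<phi>(2) by auto
  then show "x \<in> {to_ac d, - to_ac d}" by (auto simp: add_eq_0_iff2)
qed

end

lemma vs_endo_pullback:
  fixes w :: "'v \<Rightarrow> 'v"
  shows "vs_endo (\<lambda>(k :: 'k :: field) \<phi> v. k * \<phi> v) (\<lambda>\<phi> v. \<phi> (w v))"
proof -
  have vs: "vector_space (\<lambda>(k :: 'k) (\<phi> :: 'v \<Rightarrow> 'k) v. k * \<phi> v)"
    by unfold_locales (auto simp: fun_eq_iff algebra_simps)
  then show ?thesis
    by (simp add: vs_endo_def vs_endo_axioms_def Vector_Spaces.linear_iff fun_eq_iff)
qed

section \<open>Annihilating polynomials and their descent from the closure\<close>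

context vs_endo
begin

text \<open>There is one more iterate in \<open>{..card B}\<close> than there are spanning vectors.
  Two equal iterates also give a relation, hence the separate proof of injectivity.\<close>

lemma ex_annihilator_vector:
  assumes "finite B" "span B = UNIV"
  shows "\<exists>f. f \<noteq> 0 \<and> ev f v = 0"
proof (rule ccontr)
  assume contra: "\<nexists>f. f \<noteq> 0 \<and> ev f v = 0"
  have zeroI: "f = 0" if "ev f v = 0" for f using contra that by blast
  let ?p = "\<lambda>i. (u ^^ i) v" and ?I = "{..card B}"
  have inj: "inj_on ?p ?I"
  proof (rule inj_onI)
    fix i j assume "?p i = ?p j"
    then have "ev (monom 1 i - monom 1 j) v = 0" by (simp add: ev_diff ev_monom)
    then have "monom (1 :: 'a) i - monom 1 j = 0" by (rule zeroI)
    then have "monom (1 :: 'a) i = monom 1 j" by simp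
    then have "Polynomial.degree (monom (1 :: 'a) i) = Polynomial.degree (monom (1 :: 'a) j)" by simp
    then show "i = j" by (simp add: degree_monom_eq)
  qed
  have "independent (?p ` ?I)"
  proof (rule independent_if_scalars_zero)
    fix c y assume "(\<Sum>w\<in>?p ` ?I. c w *s w) = 0" and y: "y \<in> ?p ` ?I"
    then have "ev (\<Sum>i\<in>?I. monom (c (?p i)) i) v = 0"
      by (simp add: sum.reindex[OF inj] ev_sum ev_monom)
    then have zero: "(\<Sum>i\<in>?I. monom (c (?p i)) i) = 0" by (rule zeroI)
    from y obtain i where i: "y = ?p i" "i \<in> ?I" by (rule imageE)
    have "Polynomial.coeff (\<Sum>i\<in>?I. monom (c (?p i)) i) i = c (?p i)"
      using i(2) by (simp add: coeff_sum)
    then show "c y = 0" unfolding zero i(1) by simp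
  qed simp
  from independent_span_bound[OF assms(1) this] have "card (?p ` ?I) \<le> card B"
    using assms(2) by simp
  then show False by (simp add: card_image[OF inj])
qed

lemma ex_annihilator:
  assumes "basis_family K b"
  shows "\<exists>M. M \<noteq> 0 \<and> (\<forall>v. ev M v = 0)"
proof -
  have fin: "finite K" using assms by (rule basis_family_finite)
  then have "span (b ` K) = UNIV" using assms by (simp add: basis_family_iff)
  then have "\<exists>f. f \<noteq> 0 \<and> ev f v = 0" for v
    using ex_annihilator_vector[of "b ` K"] fin by blast
  then obtain f where f: "\<And>v. f v \<noteq> 0" "\<And>v. ev (f v) v = 0" by metis
  let ?M = "\<Prod>k\<in>K. f (b k)"
  have bk: "ev ?M (b k) = 0" if "k \<in> K" for k
    using dvd_prodI[OF fin that] f(2) by (rule ev_dvd)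
  have "ev ?M v = 0" for v
  proof -
    obtain a where v: "v = (\<Sum>k\<in>K. a k *s b k)" using basis_family_span[OF assms] by blast
    show ?thesis unfolding v by (simp add: ev_vsum ev_vscale bk)
  qed
  moreover have "?M \<noteq> 0" using f(1) fin by simp
  ultimately show ?thesis by blast
qed

text \<open>Over the closure the annihilator splits, and a linear factor \<open>t - \<gamma>\<close> acts injectively on the
  semilinear functionals unless \<open>\<gamma>\<close> is an eigenvalue, so it can be cancelled.\<close>

lemma linear_powers_annihilate:
  assumes basis: "basis_family K b"
    and eig: "\<And>\<phi> \<gamma> v. semilin \<phi> \<Longrightarrow> \<phi> v \<noteq> 0 \<Longrightarrow> (\<And>v. \<phi> (u v) = \<gamma> * \<phi> v) \<Longrightarrow>
      \<gamma> = to_ac d \<or> \<gamma> = to_ac e"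
  shows "\<exists>i j. \<forall>v. ev ([:- d, 1:] ^ i * [:- e, 1:] ^ j) v = 0"
proof -
  interpret T: vs_endo "\<lambda>(k :: 'a alg_closure) \<phi> v. k * \<phi> v" "\<lambda>\<phi> v. \<phi> (u v)"
    by (rule vs_endo_pullback)
  obtain M where M: "M \<noteq> 0" "\<And>v. ev M v = 0" using ex_annihilator[OF basis] by blast
  have T_map: "T.ev (map_poly to_ac f) \<phi> = (\<lambda>v. \<phi> (ev f v))" if "semilin \<phi>" for f \<phi>
    by (induction f) (simp_all add: map_poly_pCons fun_eq_iff semilin_zero[OF that]
        semilin_add[OF that] semilin_scale[OF that] ev_u)
  \<comment> \<open>Polynomials in the pullback preserve semilinearity, which keeps the eigenvalue
    hypothesis applicable to \<open>T.ev F \<phi>\<close>.\<close>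
  have T_semilin: "semilin (T.ev F \<phi>)" if "semilin \<phi>" for F \<phi>
  proof (induction F)
    case 0
    then show ?case by (simp add: semilin_def)
  next
    case (pCons k F)
    then show ?case using that by (simp add: semilin_def u_add u_scale algebra_simps)
  qed
  have cancel: "T.ev F \<phi> = 0"
    if kill: "\<And>\<phi>. semilin \<phi> \<Longrightarrow> T.ev ([:- \<gamma>, 1:] * F) \<phi> = 0" and \<gamma>: "\<gamma> \<noteq> to_ac d" "\<gamma> \<noteq> to_ac e"
      and \<phi>: "semilin \<phi>" for F \<phi> \<gamma>
  proof (rule ccontr)
    let ?\<psi> = "T.ev F \<phi>"
    assume "?\<psi> \<noteq> 0"
    then obtain v where "?\<psi> v \<noteq> 0" by (auto simp: fun_eq_iff)
    moreover have "?\<psi> (u v) = \<gamma> * ?\<psi> v" for v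
    proof -
      have "T.ev [:- \<gamma>, 1:] ?\<psi> v = 0" using kill[OF \<phi>] unfolding T.ev_mult by simp
      then show ?thesis by simp
    qed
    ultimately show False using eig[OF T_semilin[OF \<phi>]] \<gamma> by blast
  qed
  let ?X = "[:- to_ac d, 1:]" and ?Y = "[:- to_ac e, 1:]"
  \<comment> \<open>\<open>F\<close> is arbitrary so that the induction can move the current factor
    t - \<gamma> into it; afterwards the factor is absorbed into one of the two powers or
    cancelled.\<close>
  have drop: "\<exists>i j. \<forall>\<phi>. semilin \<phi> \<longrightarrow> T.ev (?X ^ i * ?Y ^ j * F) \<phi> = 0"
    if "\<And>\<phi>. semilin \<phi> \<Longrightarrow> T.ev ((\<Prod>x\<in>#A. [:- x, 1:]) * F) \<phi> = 0" for A F
    using that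
  proof (induction A arbitrary: F)
    case empty
    then show ?case by (intro exI[of _ 0]) simp
  next
    case (add \<gamma> A)
    have "(\<Prod>x\<in>#add_mset \<gamma> A. [:- x, 1:]) * F = (\<Prod>x\<in>#A. [:- x, 1:]) * ([:- \<gamma>, 1:] * F)"
      unfolding image_mset_add_mset prod_mset.add_mset by (simp only: mult_ac)
    then have "\<And>\<phi>. semilin \<phi> \<Longrightarrow> T.ev ((\<Prod>x\<in>#A. [:- x, 1:]) * ([:- \<gamma>, 1:] * F)) \<phi> = 0"
      using add.prems by (simp only:)
    from add.IH[OF this] obtain i j
      where ij: "\<And>\<phi>. semilin \<phi> \<Longrightarrow> T.ev (?X ^ i * ?Y ^ j * ([:- \<gamma>, 1:] * F)) \<phi> = 0" by blast
    consider "\<gamma> = to_ac d" | "\<gamma> = to_ac e" | "\<gamma> \<noteq> to_ac d" "\<gamma> \<noteq> to_ac e" by blast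
    then show ?case
    proof cases
      case 1
      have eq: "?X ^ i * ?Y ^ j * ([:- \<gamma>, 1:] * F) = ?X ^ Suc i * ?Y ^ j * F"
        unfolding 1 power_Suc by (simp only: mult_ac)
      have "\<forall>\<phi>. semilin \<phi> \<longrightarrow> T.ev (?X ^ Suc i * ?Y ^ j * F) \<phi> = 0"
        unfolding eq[symmetric] by (intro allI impI ij)
      then show ?thesis by - (rule exI, rule exI)
    next
      case 2
      have eq: "?X ^ i * ?Y ^ j * ([:- \<gamma>, 1:] * F) = ?X ^ i * ?Y ^ Suc j * F"
        unfolding 2 power_Suc by (simp only: mult_ac)
      have "\<forall>\<phi>. semilin \<phi> \<longrightarrow> T.ev (?X ^ i * ?Y ^ Suc j * F) \<phi> = 0"
        unfolding eq[symmetric] by (intro allI impI ij)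
      then show ?thesis by - (rule exI, rule exI)
    next
      case 3
      have eq: "?X ^ i * ?Y ^ j * ([:- \<gamma>, 1:] * F) = [:- \<gamma>, 1:] * (?X ^ i * ?Y ^ j * F)"
        by (simp only: mult_ac)
      have "T.ev ([:- \<gamma>, 1:] * (?X ^ i * ?Y ^ j * F)) \<phi> = 0" if s: "semilin \<phi>" for \<phi>
        unfolding eq[symmetric] by (rule ij[OF s])
      from cancel[OF this 3] have "\<forall>\<phi>. semilin \<phi> \<longrightarrow> T.ev (?X ^ i * ?Y ^ j * F) \<phi> = 0"
        by (intro allI impI)
      then show ?thesis by - (rule exI, rule exI)
    qed
  qed
  let ?M = "map_poly to_ac M"
  have TM: "T.ev ?M \<phi> = 0" if "semilin \<phi>" for \<phi>
    unfolding T_map[OF that] by (simp add: M semilin_zero[OF that] fun_eq_iff)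
  obtain A where A: "?M = Polynomial.smult (lead_coeff ?M) (\<Prod>x\<in>#A. [:- x, 1:])"
    using alg_closed_imp_factorization[of ?M] M(1) by (auto simp: map_poly_eq_0_iff)
  have "(\<Prod>x\<in>#A. [:- x, 1:]) * [:lead_coeff ?M:] = Polynomial.smult (lead_coeff ?M) (\<Prod>x\<in>#A. [:- x, 1:])"
    by simp
  also have "\<dots> = ?M" by (rule A[symmetric])
  finally have eq: "(\<Prod>x\<in>#A. [:- x, 1:]) * [:lead_coeff ?M:] = ?M" .
  have "T.ev ((\<Prod>x\<in>#A. [:- x, 1:]) * [:lead_coeff ?M:]) \<phi> = 0" if "semilin \<phi>" for \<phi>
    unfolding eq by (rule TM[OF that])
  from drop[OF this] obtain i j where
    ij: "\<And>\<phi>. semilin \<phi> \<Longrightarrow> T.ev (?X ^ i * ?Y ^ j * [:lead_coeff ?M:]) \<phi> = 0" by blast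
  have lc: "lead_coeff ?M \<noteq> 0" using M(1) by (simp add: map_poly_eq_0_iff)
  have T_lin: "T.ev ([:- to_ac l, 1:] ^ n) \<phi> = (\<lambda>v. \<phi> (ev ([:- l, 1:] ^ n) v))"
    if "semilin \<phi>" for l n \<phi>
  proof (induction n)
    case (Suc n)
    have "ev ([:- l, 1:] * [:- l, 1:] ^ n) v = u (ev ([:- l, 1:] ^ n) v) - l *s ev ([:- l, 1:] ^ n) v" for v
      unfolding ev_mult by simp
    then show ?case
      unfolding power_Suc T.ev_mult Suc.IH
      by (simp add: fun_eq_iff semilin_diff[OF that] semilin_scale[OF that] ev_u
          del: mult_pCons_left)
  qed simp
  have "ev ([:- d, 1:] ^ i * [:- e, 1:] ^ j) v = 0" for v
  proof (rule ccontr)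
    let ?w = "ev ([:- d, 1:] ^ i * [:- e, 1:] ^ j) v"
    assume nz: "?w \<noteq> 0"
    obtain a where w: "?w = (\<Sum>k\<in>K. a k *s b k)" using basis_family_span[OF basis] by blast
    obtain k where k: "k \<in> K" "a k \<noteq> 0"
      using nz unfolding w by (metis (mono_tags, lifting) scale_zero_left sum.neutral)
    \<comment> \<open>Descent to \<open>V\<close>: the functional reading off a nonzero coordinate
      of \<open>?w\<close> does not vanish at \<open>?w\<close>, but by \<open>ij\<close> every
      semilinear functional does, as the leading coefficient is nonzero.\<close>
    obtain \<phi> where \<phi>: "semilin \<phi>" "\<And>j. j \<in> K \<Longrightarrow> \<phi> (b j) = (if j = k then 1 else 0)"
      using semilin_extend[OF basis, of "\<lambda>j. if j = k then 1 else 0"] by blast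
    have "\<phi> ?w = (\<Sum>j\<in>K. if j = k then to_ac (a k) else 0)"
      unfolding w semilin_sum[OF \<phi>(1)] semilin_scale[OF \<phi>(1)] by (rule sum.cong) (simp_all add: \<phi>(2))
    then have "\<phi> ?w = to_ac (a k)" using k basis_family_finite[OF basis] by simp
    moreover have "lead_coeff ?M * \<phi> ?w = 0"
    proof -
      have "T.ev (?X ^ i * ?Y ^ j * [:lead_coeff ?M:]) \<phi>
          = T.ev ([:lead_coeff ?M:] * (?X ^ i * ?Y ^ j)) \<phi>"
        by (subst mult.commute) (rule refl)
      also have "\<dots> = T.ev [:lead_coeff ?M:] (T.ev (?X ^ i) (T.ev (?Y ^ j) \<phi>))"
        by (simp only: T.ev_mult)
      also have "\<dots> = T.ev [:lead_coeff ?M:] (\<lambda>v. T.ev (?Y ^ j) \<phi> (ev ([:- d, 1:] ^ i) v))"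
        by (simp only: T_lin[OF T_semilin[OF \<phi>(1)]])
      also have "\<dots> = T.ev [:lead_coeff ?M:] (\<lambda>v. \<phi> (ev ([:- e, 1:] ^ j) (ev ([:- d, 1:] ^ i) v)))"
        by (simp only: T_lin[OF \<phi>(1)])
      finally have "T.ev [:lead_coeff ?M:] (\<lambda>v. \<phi> (ev ([:- e, 1:] ^ j) (ev ([:- d, 1:] ^ i) v))) = 0"
        using ij[OF \<phi>(1)] by simp
      then have "(lead_coeff ?M) * \<phi> (ev ([:- e, 1:] ^ j) (ev ([:- d, 1:] ^ i) v)) = 0"
        by (auto simp: fun_eq_iff)
      then show ?thesis by (simp only: ev_mult ev_commute[of "[:- e, 1:] ^ j"])
    qed
    ultimately show False using lc k(2) by simp
  qed
  then show ?thesis by blast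
qed

end

section \<open>Minimal generating families\<close>

locale conj_endo = vs_endo scale u
  for scale :: "'a :: field \<Rightarrow> 'v :: ab_group_add \<Rightarrow> 'v" (infixr \<open>*s\<close> 75) and u +
  fixes a :: "'v \<Rightarrow> 'v" and c d :: 'a
  assumes linear_a: "Vector_Spaces.linear scale scale a"
    and a_a: "a (a v) = c *s v"
    and u_a_u: "u (a (u v)) = d ^ 2 *s a v"
    and bij: "bij u"
    and d_nz: "d \<noteq> 0"
    and nonsquare: "l ^ 2 \<noteq> c"
begin

sublocale A: vs_endo scale a
  by (rule vs_endoI) (rule linear_a)

lemma u_inj: "u x = u y \<Longrightarrow> x = y"
  using bij by (simp add: bij_is_inj inj_eq)

lemma ex_pow_preimage: "\<exists>z. v = (u ^^ n) z"
  using surjD[OF bij_is_surj[OF bij_betw_funpow[OF bij]]] .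

lemma pow_inj: "(u ^^ n) v = 0 \<Longrightarrow> v = 0"
  using injD[OF bij_is_inj[OF bij_betw_funpow[OF bij, of n]], of v 0] pow_zero by simp

text \<open>For l^2 = d^2 one has (u - l) a u = d^2 a - l a u = -l a (u - l). The power of
  \<open>u\<close> inside the argument clears the denominators that a u = d^2 u^-1 a would bring
  in.\<close>

lemma linear_power_a:
  assumes "l ^ 2 = d ^ 2"
  shows "ev ([:- l, 1:] ^ n) (a ((u ^^ n) v)) = (- l) ^ n *s a (ev ([:- l, 1:] ^ n) v)"
proof (induction n arbitrary: v)
  case (Suc n)
  have step: "ev [:- l, 1:] (a (u w)) = (- l) *s a (ev [:- l, 1:] w)" for w
  proof -
    have "ev [:- l, 1:] (a (u w)) = u (a (u w)) - l *s a (u w)"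
      "ev [:- l, 1:] w = u w - l *s w" by simp_all
    then show ?thesis
      using assms by (simp add: u_a_u A.u_diff A.u_scale scale_right_diff_distrib power2_eq_square)
  qed
  have "ev ([:- l, 1:] ^ Suc n) (a ((u ^^ Suc n) v)) = ev ([:- l, 1:] ^ n) (ev [:- l, 1:] (a (u ((u ^^ n) v))))"
    by (simp only: power_Suc2 ev_mult funpow.simps o_apply)
  also have "\<dots> = (- l) *s ev ([:- l, 1:] ^ n) (a ((u ^^ n) (ev [:- l, 1:] v)))"
    by (simp only: step ev_vscale pow_ev)
  also have "\<dots> = (- l) ^ Suc n *s a (ev ([:- l, 1:] ^ Suc n) v)"
    by (simp only: Suc.IH scale_scale power_Suc ev_mult ev_commute[of "[:- l, 1:]" "[:- l, 1:] ^ n"])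
  finally show ?case .
qed simp

text \<open>This lets x and a x share one exponent in a pair. Surjectivity of \<open>u\<close>
  supplies the power of \<open>u\<close> that the preceding identity requires.\<close>

lemma linear_power_a_zero:
  assumes "l ^ 2 = d ^ 2" "ev ([:- l, 1:] ^ n) x = 0"
  shows "ev ([:- l, 1:] ^ n) (a x) = 0"
proof -
  obtain z where z: "x = (u ^^ n) z" using ex_pow_preimage by blast
  have "(u ^^ n) (ev ([:- l, 1:] ^ n) z) = 0" using assms(2) by (simp only: z pow_ev)
  then have "ev ([:- l, 1:] ^ n) z = 0" by (rule pow_inj)
  then show ?thesis unfolding z linear_power_a[OF assms(1)] by simp
qed

definition stable :: "'v set \<Rightarrow> bool" where
  "stable T \<longleftrightarrow> subspace T \<and> (\<forall>v\<in>T. u v \<in> T \<and> a v \<in> T)"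

lemma stable_subspace: "stable T \<Longrightarrow> subspace T"
  and stable_a: "stable T \<Longrightarrow> v \<in> T \<Longrightarrow> a v \<in> T"
  and stable_u: "stable T \<Longrightarrow> v \<in> T \<Longrightarrow> u v \<in> T"
  by (auto simp: stable_def)

lemma stable_ev: "stable T \<Longrightarrow> v \<in> T \<Longrightarrow> ev f v \<in> T"
  by (induction f)
    (auto intro: subspace_0 subspace_add subspace_scale stable_u dest: stable_subspace)

text \<open>Testing against all stable subspaces makes an exchange of generators easy to verify: the
  old generator has only to be recovered inside a subspace containing the new ones.\<close>

definition generates :: "'j set \<Rightarrow> ('j \<Rightarrow> 'v) \<Rightarrow> bool" where
  "generates J x \<longleftrightarrow> (\<forall>T. stable T \<longrightarrow> x ` J \<subseteq> T \<longrightarrow> T = UNIV)"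

definition pair_gen :: "('j \<Rightarrow> 'v) \<Rightarrow> 'j \<times> bool \<Rightarrow> 'v" where
  "pair_gen x = (\<lambda>(j, b). if b then x j else a (x j))"

text \<open>The combinations with polynomial coefficients already form a stable subspace. Closure
  under \<open>a\<close> holds because u^-1 = g(u): moving \<open>a\<close> past h(u) replaces h(u)
  by h(d^2 g(u)).\<close>

lemma generates_span:
  assumes "finite J" "generates J x" and g: "\<And>v. u (ev g v) = v"
  shows "\<exists>f. v = (\<Sum>p\<in>J \<times> (UNIV :: bool set). ev (f p) (pair_gen x p))"
proof -
  let ?I = "J \<times> (UNIV :: bool set)"
  define e where "e = (\<lambda>f. \<Sum>p\<in>?I. ev (f p) (pair_gen x p))"
  have "e (\<lambda>_. 0) = 0" by (simp add: e_def)
  moreover have "e f + e h = e (\<lambda>p. f p + h p)" for f h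
    by (simp add: e_def ev_add sum.distrib)
  moreover have "k *s e f = e (\<lambda>p. Polynomial.smult k (f p))" for k f
    by (simp add: e_def ev_smult scale_sum_right)
  ultimately have "subspace (range e)"
    unfolding subspace_def by (metis (no_types, lifting) rangeE rangeI)
  moreover have "u (e f) \<in> range e" for f
  proof -
    have "u (e f) = e (\<lambda>p. pCons 0 (f p))" by (simp add: e_def u_sum)
    then show ?thesis by simp
  qed
  moreover have "a (e f) \<in> range e" for f
  proof -
    let ?g = "Polynomial.smult (d ^ 2) g"
    have au: "a (u v) = ev ?g (a v)" for v
      by (rule u_inj) (simp add: u_a_u ev_smult u_scale g)
    have a_ev: "a (ev h v) = ev (pcompose h ?g) (a v)" for h v
    proof (induction h arbitrary: v)
      case (pCons k h)
      have "a (ev (pCons k h) v) = k *s a v + ev ?g (a (ev h v))"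
        by (simp add: A.u_add A.u_scale au)
      also have "\<dots> = ev (pcompose (pCons k h) ?g) (a v)"
        unfolding pCons.IH pcompose_pCons ev_add ev_mult by simp
      finally show ?case .
    qed (simp add: A.u_zero)
    \<comment> \<open>\<open>a\<close> sends \<open>x j\<close> to \<open>a (x j)\<close> and
      \<open>a (x j)\<close> to \<open>c *s x j\<close>, so the two coefficients change places and
      one acquires the factor \<open>c\<close>.\<close>
    define h where "h = (\<lambda>(j, b). if b then Polynomial.smult c (pcompose (f (j, False)) ?g)
      else pcompose (f (j, True)) ?g)"
    have "a (e f) = e h"
      by (simp add: e_def h_def sum_times_bool A.u_sum A.u_add a_ev pair_gen_def a_a ev_vscale ev_smult
          add.commute cong: sum.cong_simp)
    then show ?thesis by simp
  qed
  ultimately have "stable (range e)" unfolding stable_def by blast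
  moreover have "x ` J \<subseteq> range e"
  proof
    fix y assume "y \<in> x ` J"
    then obtain j where j: "y = x j" "j \<in> J" by (rule imageE)
    have "e (\<lambda>p. if p = (j, True) then 1 else 0) = (\<Sum>p\<in>?I. if p = (j, True) then x j else 0)"
      unfolding e_def by (rule sum.cong) (auto simp: pair_gen_def)
    also have "\<dots> = y" using assms(1) j by simp
    finally show "y \<in> range e" by (metis rangeI)
  qed
  ultimately have "range e = UNIV" using assms(2) unfolding generates_def by blast
  then have "v \<in> range e" by simp
  then obtain f where "v = e f" by (rule rangeE)
  then show ?thesis unfolding e_def by - (rule exI)
qed

text \<open>\<open>n j\<close> only bounds the order of \<open>x j\<close>, and
  \<open>n j = 0\<close> with \<open>x j = 0\<close> is possible; so \<open>J\<close> and
  \<open>l\<close> can stay fixed while the total exponent decreases.\<close>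

definition gen_family :: "'j set \<Rightarrow> ('j \<Rightarrow> 'v) \<Rightarrow> ('j \<Rightarrow> 'a) \<Rightarrow> ('j \<Rightarrow> nat) \<Rightarrow> bool" where
  "gen_family J x l n \<longleftrightarrow> generates J x \<and>
     (\<forall>j\<in>J. l j \<in> {d, - d} \<and> ev ([:- l j, 1:] ^ n j) (x j) = 0)"

text \<open>Multiply the given relation by a power of \<open>t + \<lambda>\<close>, which kills the terms with \<open>l\<^sub>j = - \<lambda>\<close>, and then by
  the largest power of \<open>t - \<lambda>\<close> that leaves a nonzero term. What remains is a relation between the
  \<open>(t - \<lambda>)\<^bsup>n\<^sub>j-1\<^esup> z\<^sub>j\<close> with scalar coefficients.\<close>

lemma socle_relation:
  assumes "finite J" and two: "d \<noteq> - d"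
    and l: "\<And>j. j \<in> J \<Longrightarrow> l j \<in> {d, - d}"
    and ann: "\<And>j b. j \<in> J \<Longrightarrow> ev ([:- l j, 1:] ^ n j) (z (j, b)) = 0"
    and rel: "(\<Sum>p\<in>J \<times> (UNIV :: bool set). ev (f p) (z p)) = 0"
    and j0: "j0 \<in> J" "\<not> [:- l j0, 1:] ^ n j0 dvd f (j0, b0)"
  shows "\<exists>lam \<alpha>. lam \<in> {d, - d} \<and> (\<exists>j\<in>J. \<exists>b. \<alpha> (j, b) \<noteq> 0) \<and>
    (\<forall>j\<in>J. \<forall>b. \<alpha> (j, b) \<noteq> 0 \<longrightarrow> l j = lam \<and> n j > 0) \<and>
    (\<Sum>p\<in>J \<times> (UNIV :: bool set). \<alpha> p *s ev ([:- lam, 1:] ^ (n (fst p) - 1)) (z p)) = 0"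
proof -
  let ?I = "J \<times> (UNIV :: bool set)"
  define lam where "lam = l j0"
  have lam: "lam \<in> {d, - d}" using l[OF j0(1)] by (simp add: lam_def)
  have lam2: "lam \<noteq> - lam" using lam two by auto
  define lin where "lin = [:- lam, 1:]"
  define N where "N = (\<Sum>j\<in>J. n j)"
  have nN: "n j \<le> N" if "j \<in> J" for j
    unfolding N_def by (rule member_le_sum) (use that assms(1) in auto)
  let ?h = "[:- (- lam), 1:] ^ N"
  define F where "F = (\<lambda>p. ?h * f p)"
  have F_other: "[:- l j, 1:] ^ n j dvd F (j, b)" if "j \<in> J" "l j \<noteq> lam" for j b
  proof -
    have "l j = - lam" using l[OF that(1)] that(2) lam by auto
    then show ?thesis
      unfolding F_def using le_imp_power_dvd[OF nN[OF that(1)], of "[:- l j, 1:]"] by simp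
  qed
  \<comment> \<open>The multiplier is coprime to \<open>lin\<close>, so it cannot repair the failing
    divisibility.\<close>
  have F_j0: "\<not> lin ^ n j0 dvd F (j0, b0)"
  proof
    assume dvd: "lin ^ n j0 dvd F (j0, b0)"
    obtain A B where AB: "A * lin ^ n j0 + B * ?h = 1"
      using bezout_linear_powers[OF lam2, of "n j0" N] unfolding lin_def by blast
    have "f (j0, b0) = (A * lin ^ n j0 + B * ?h) * f (j0, b0)" by (simp only: AB mult_1_left)
    also have "\<dots> = A * f (j0, b0) * lin ^ n j0 + B * F (j0, b0)"
      unfolding F_def distrib_right by (simp only: mult_ac)
    also have "lin ^ n j0 dvd \<dots>" using dvd by (intro dvd_add dvd_mult) simp_all
    finally show False using j0(2) by (simp add: lin_def lam_def)
  qed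
  define good where "good = (\<lambda>k. \<forall>j\<in>J. \<forall>b. l j = lam \<longrightarrow> lin ^ n j dvd lin ^ k * F (j, b))"
  have "good N"
    unfolding good_def using le_imp_power_dvd[OF nN] by (auto intro: dvd_mult2)
  have "\<not> good 0"
    unfolding good_def using F_j0 j0(1) by (auto simp: lam_def)
  have "\<exists>k. \<not> good k \<and> good (Suc k)"
  proof (rule ccontr)
    assume *: "\<nexists>k. \<not> good k \<and> good (Suc k)"
    have "\<not> good k" for k
      by (induction k) (use * \<open>\<not> good 0\<close> in auto)
    then show False using \<open>good N\<close> by blast
  qed
  then obtain k where k: "\<not> good k" "good (Suc k)" by blast
  define G where "G = (\<lambda>p. lin ^ k * F p)"
  have G_other: "[:- l j, 1:] ^ n j dvd G (j, b)" if "j \<in> J" "l j \<noteq> lam" for j b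
    unfolding G_def using F_other[OF that] by (rule dvd_mult)
  have G_same: "lin ^ n j dvd lin * G (j, b)" if "j \<in> J" "l j = lam" for j b
    using k(2) that by (simp add: good_def G_def mult.assoc)
  obtain j1 b1 where j1: "j1 \<in> J" "l j1 = lam" "\<not> lin ^ n j1 dvd G (j1, b1)"
    using k(1) unfolding good_def G_def by blast
  have nz: "lin \<noteq> 0" by (simp add: lin_def)
  have ex_q: "\<exists>q. G (j, b) = lin ^ (n j - 1) * q" if "j \<in> J" "l j = lam" "n j > 0" for j b
  proof -
    have "lin * lin ^ (n j - 1) dvd lin * G (j, b)"
      using G_same[OF that(1,2)] that(3) by (cases "n j") simp_all
    then have "lin ^ (n j - 1) dvd G (j, b)" using nz dvd_mult_cancel_left[of lin] by blast
    then show ?thesis by (auto elim: dvdE)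
  qed
  define q where "q = (\<lambda>(j, b). SOME q. G (j, b) = lin ^ (n j - 1) * q)"
  have q: "G (j, b) = lin ^ (n j - 1) * q (j, b)" if "j \<in> J" "l j = lam" "n j > 0" for j b
    using someI_ex[OF ex_q[OF that, of b]] by (simp add: q_def)
  \<comment> \<open>The coefficient is \<open>lin ^ (n j - 1) * q\<close>, and
    \<open>lin ^ n j\<close> kills the generator; so only \<open>q\<close> modulo
    \<open>lin\<close>, that is its value at \<open>lam\<close>, matters. Indices whose term
    vanishes because \<open>l j\<close> is not \<open>lam\<close> or \<open>n j = 0\<close> get
    0.\<close>
  define \<alpha> where "\<alpha> = (\<lambda>p. if l (fst p) = lam \<and> n (fst p) > 0 then poly (q p) lam else 0)"
  have pow_Suc: "lin ^ n j = lin ^ (n j - 1) * lin" if "n j > 0" for j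
    using that by (cases "n j") (simp_all only: power_Suc2 diff_Suc_1)
  have term_eq: "ev (G (j, b)) (z (j, b)) = \<alpha> (j, b) *s ev (lin ^ (n j - 1)) (z (j, b))" if j: "j \<in> J" for j b
  proof (cases "l j = lam \<and> n j > 0")
    case False
    have "[:- l j, 1:] ^ n j dvd G (j, b)"
      using False G_other[OF j, of b] by (cases "l j = lam") auto
    then have "ev (G (j, b)) (z (j, b)) = 0" using ann[OF j] by (rule ev_dvd)
    moreover have "\<alpha> (j, b) = 0" using False unfolding \<alpha>_def by (intro if_not_P) simp
    ultimately show ?thesis by simp
  next
    case True
    then have lj: "l j = lam" and nj: "n j > 0" by auto
    have "poly (q (j, b) - [:\<alpha> (j, b):]) lam = 0" using True by (simp add: \<alpha>_def)
    then obtain q' where q': "q (j, b) - [:\<alpha> (j, b):] = lin * q'"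
      unfolding poly_eq_0_iff_dvd lin_def by (rule dvdE)
    have "G (j, b) = lin ^ (n j - 1) * [:\<alpha> (j, b):] + lin ^ (n j - 1) * (q (j, b) - [:\<alpha> (j, b):])"
      unfolding q[OF j lj nj] by (simp only: right_diff_distrib) simp
    also have "\<dots> = Polynomial.smult (\<alpha> (j, b)) (lin ^ (n j - 1)) + lin ^ n j * q'"
      unfolding q' pow_Suc[OF nj] by (simp add: mult.assoc)
    finally have G: "G (j, b) = Polynomial.smult (\<alpha> (j, b)) (lin ^ (n j - 1)) + lin ^ n j * q'" .
    have "ev (lin ^ n j) (z (j, b)) = 0" using ann[OF j] lj by (simp add: lin_def)
    then have "ev (lin ^ n j * q') (z (j, b)) = 0" by (intro ev_dvd[OF dvd_triv_left])
    then show ?thesis unfolding G by (simp add: ev_add ev_smult)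
  qed
  have "\<alpha> (j1, b1) \<noteq> 0"
  proof
    assume zero: "\<alpha> (j1, b1) = 0"
    have n1: "n j1 > 0" using j1(3) by (cases "n j1") auto
    then have "poly (q (j1, b1)) lam = 0" using zero j1(2) by (simp add: \<alpha>_def)
    then have "lin dvd q (j1, b1)" unfolding poly_eq_0_iff_dvd lin_def .
    then have "lin ^ n j1 dvd G (j1, b1)"
      unfolding q[OF j1(1,2) n1] pow_Suc[OF n1] by (intro mult_dvd_mono) simp_all
    then show False using j1(3) by simp
  qed
  then have "\<exists>j\<in>J. \<exists>b. \<alpha> (j, b) \<noteq> 0" using j1(1) by blast
  moreover have "\<forall>j\<in>J. \<forall>b. \<alpha> (j, b) \<noteq> 0 \<longrightarrow> l j = lam \<and> n j > 0" by (auto simp: \<alpha>_def)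
  moreover have "(\<Sum>p\<in>?I. \<alpha> p *s ev ([:- lam, 1:] ^ (n (fst p) - 1)) (z p)) = 0"
  proof -
    have "(\<Sum>p\<in>?I. \<alpha> p *s ev (lin ^ (n (fst p) - 1)) (z p)) = (\<Sum>p\<in>?I. ev (G p) (z p))"
      by (rule sum.cong) (auto simp: term_eq)
    also have "\<dots> = ev (lin ^ k * ?h) (\<Sum>p\<in>?I. ev (f p) (z p))"
      unfolding ev_vsum by (rule sum.cong) (simp_all only: G_def F_def ev_mult)
    also have "\<dots> = 0" by (simp add: rel)
    finally show ?thesis by (simp only: lin_def)
  qed
  ultimately show ?thesis using lam by blast
qed

text \<open>The relation \<open>\<Sum> (t - \<lambda>)\<^bsup>n\<^sub>j-1\<^esup> \<theta>\<^sub>j x\<^sub>j = 0\<close> with \<open>\<theta>\<^sub>j = \<alpha>\<^sub>j + \<beta>\<^sub>j a\<close> allows to replace the \<open>x\<^sub>i\<close> with the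
  smallest \<open>n\<^sub>i\<close> by \<open>\<Sum> (t - \<lambda>)\<^bsup>n\<^sub>j-n\<^sub>i\<^esup> \<theta>\<^sub>j x\<^sub>j\<close>, which has smaller order. The \<open>\<theta>\<^sub>j\<close> are invertible because \<open>c\<close>
  is not a square.\<close>

lemma gen_family_reduce:
  assumes J: "finite J" and two: "d \<noteq> - d" and gf: "gen_family J x l n"
    and rel: "(\<Sum>p\<in>J \<times> (UNIV :: bool set). ev (f p) (pair_gen x p)) = 0"
    and j0: "j0 \<in> J" "\<not> [:- l j0, 1:] ^ n j0 dvd f (j0, b0)"
  shows "\<exists>x' n'. gen_family J x' l n' \<and> (\<Sum>j\<in>J. n' j) < (\<Sum>j\<in>J. n j)"
proof -
  have gen: "generates J x" and l: "\<And>j. j \<in> J \<Longrightarrow> l j \<in> {d, - d}"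
    and annx: "\<And>j. j \<in> J \<Longrightarrow> ev ([:- l j, 1:] ^ n j) (x j) = 0"
    using gf unfolding gen_family_def by blast+
  have ann: "ev ([:- l j, 1:] ^ n j) (pair_gen x (j, b)) = 0" if "j \<in> J" for j b
    using annx[OF that] linear_power_a_zero[OF _ annx[OF that]] l[OF that] by (auto simp: pair_gen_def)
  obtain lam \<alpha> where ex: "\<exists>j\<in>J. \<exists>b. \<alpha> (j, b) \<noteq> 0"
    and \<alpha>: "\<And>j b. j \<in> J \<Longrightarrow> \<alpha> (j, b) \<noteq> 0 \<Longrightarrow> l j = lam \<and> n j > 0"
    and rel': "(\<Sum>p\<in>J \<times> (UNIV :: bool set). \<alpha> p *s ev ([:- lam, 1:] ^ (n (fst p) - 1)) (pair_gen x p)) = 0"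
    using socle_relation[OF J two l ann rel j0] by blast
  let ?lin = "[:- lam, 1:]"
  define y where "y = (\<lambda>j. \<alpha> (j, True) *s x j + \<alpha> (j, False) *s a (x j))"
  \<comment> \<open>On these indices the eigenvalue is \<open>lam\<close> and the exponent is
    positive, so lowering the exponent of one of them by 1 is a genuine decrease.\<close>
  define J' where "J' = {j \<in> J. \<alpha> (j, True) \<noteq> 0 \<or> \<alpha> (j, False) \<noteq> 0}"
  have J': "finite J'" "J' \<subseteq> J" using J by (auto simp: J'_def)
  have "J' \<noteq> {}"
  proof -
    obtain j b where "j \<in> J" "\<alpha> (j, b) \<noteq> 0" using ex by blast
    then have "j \<in> J'" by (cases b) (auto simp: J'_def)
    then show ?thesis by blast
  qed
  then obtain i where i: "i \<in> J'" and i_min: "\<And>j. j \<in> J' \<Longrightarrow> n i \<le> n j"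
    using ex_min_if_finite[OF finite_imageI[OF J'(1), of n]]
    by (metis (no_types, lifting) arg_min_if_finite J'(1) not_le)
  have iJ: "i \<in> J" using i J'(2) by blast
  have J'_l: "l j = lam \<and> n j > 0" if "j \<in> J'" for j
    using that \<alpha> by (auto simp: J'_def)
  define x' where "x' = (\<Sum>j\<in>J'. ev (?lin ^ (n j - n i)) (y j))"
  have "ev (?lin ^ (n i - 1)) x' = 0"
  proof -
    have "ev (?lin ^ (n i - 1)) (ev (?lin ^ (n j - n i)) (y j)) = ev (?lin ^ (n j - 1)) (y j)" if "j \<in> J'" for j
    proof -
      have "n i - 1 + (n j - n i) = n j - 1" using i_min[OF that] J'_l[OF i] by linarith
      then show ?thesis by (simp only: ev_mult[symmetric] power_add[symmetric])
    qed
    then have "ev (?lin ^ (n i - 1)) x' = (\<Sum>j\<in>J'. ev (?lin ^ (n j - 1)) (y j))"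
      by (simp add: x'_def ev_vsum)
    also have "\<dots> = (\<Sum>j\<in>J. ev (?lin ^ (n j - 1)) (y j))"
      using J J' by (intro sum.mono_neutral_left) (auto simp: J'_def y_def)
    also have "\<dots> = 0"
      using rel' by (simp add: sum_times_bool y_def ev_vadd ev_vscale pair_gen_def)
    finally show ?thesis .
  qed
  then have ann': "ev ([:- l i, 1:] ^ (n i - 1)) x' = 0" using J'_l[OF i] by simp
  have "generates J (x(i := x'))"
    unfolding generates_def
  proof (intro allI impI)
    fix T assume T: "stable T" and sub: "x(i := x') ` J \<subseteq> T"
    have sp: "subspace T" using T by (rule stable_subspace)
    have xT: "x j \<in> T" if "j \<in> J" "j \<noteq> i" for j
    proof -
      have "(x(i := x')) j \<in> T" using sub that(1) by blast
      then show ?thesis using that(2) by simp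
    qed
    have "(x(i := x')) i \<in> T" using sub iJ by blast
    then have x'T: "x' \<in> T" by simp
    have "y j \<in> T" if "j \<in> J" "j \<noteq> i" for j
      unfolding y_def by (intro subspace_add[OF sp] subspace_scale[OF sp] stable_a[OF T] xT that)
    then have "(\<Sum>j\<in>J' - {i}. ev (?lin ^ (n j - n i)) (y j)) \<in> T"
      using J'(2) by (intro subspace_sum[OF sp] stable_ev[OF T]) blast
    \<comment> \<open>The term of index \<open>i\<close> has exponent 0, so \<open>y i\<close> is
      recovered from \<open>x'\<close> and the other generators.\<close>
    moreover have "x' = y i + (\<Sum>j\<in>J' - {i}. ev (?lin ^ (n j - n i)) (y j))"
      unfolding x'_def using sum.remove[OF J'(1) i, of "\<lambda>j. ev (?lin ^ (n j - n i)) (y j)"] by simp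
    ultimately have yT: "y i \<in> T"
      using subspace_diff[OF sp x'T] by fastforce
    let ?\<alpha> = "\<alpha> (i, True)" and ?\<beta> = "\<alpha> (i, False)"
    \<comment> \<open>The conjugate \<alpha> - \<beta> a is applied to \<open>y i\<close> =
      (\<alpha> + \<beta> a) x i, which leaves the norm \<alpha>^2 - \<beta>^2 c times
      \<open>x i\<close>.\<close>
    have "?\<alpha> *s y i - ?\<beta> *s a (y i) \<in> T"
      by (intro subspace_diff[OF sp] subspace_scale[OF sp] stable_a[OF T] yT)
    moreover have "?\<alpha> *s y i - ?\<beta> *s a (y i) = (?\<alpha> ^ 2 - ?\<beta> ^ 2 * c) *s x i"
      by (simp add: y_def A.u_add A.u_scale a_a scale_right_distrib scale_left_diff_distrib
          power2_eq_square mult.commute mult.left_commute)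
    moreover have "?\<alpha> ^ 2 - ?\<beta> ^ 2 * c \<noteq> 0"
    proof (cases "?\<beta> = 0")
      case True
      then show ?thesis using i by (simp add: J'_def)
    next
      case False
      have "(?\<alpha> / ?\<beta>) ^ 2 \<noteq> c" by (rule nonsquare)
      then show ?thesis using False by (simp add: power_divide field_simps)
    qed
    ultimately have "inverse (?\<alpha> ^ 2 - ?\<beta> ^ 2 * c) *s ((?\<alpha> ^ 2 - ?\<beta> ^ 2 * c) *s x i) \<in> T"
      using subspace_scale[OF sp] by (simp only:)
    then have "x i \<in> T" using \<open>?\<alpha> ^ 2 - ?\<beta> ^ 2 * c \<noteq> 0\<close> by (simp del: scale_left_diff_distrib)
    then have "x ` J \<subseteq> T" using xT by blast
    then show "T = UNIV" using gen T unfolding generates_def by blast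
  qed
  then have "gen_family J (x(i := x')) l (n(i := n i - 1))"
    using l annx ann' by (simp add: gen_family_def)
  moreover have "(\<Sum>j\<in>J. (n(i := n i - 1)) j) < (\<Sum>j\<in>J. n j)"
    using J'_l[OF i] iJ J by (intro sum_strict_mono_ex1) auto
  ultimately show ?thesis by blast
qed

text \<open>For a family of least total exponent, \<open>gen_family_reduce\<close> excludes every
  relation that violates a divisibility, so directness and the exact annihilators come
  together.\<close>

lemma conj_imp_paired_decomp:
  fixes b :: "'i \<Rightarrow> 'v"
  assumes basis: "basis_family K b" and two: "d \<noteq> - d"
    and ann: "\<And>v. ev ([:- d, 1:] ^ i * [:- (- d), 1:] ^ j) v = 0"
  shows "paired_decomp d"
proof -
  let ?X = "[:- d, 1:] ^ i" and ?Y = "[:- (- d), 1:] ^ j"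
  obtain A B where AB: "A * ?X + B * ?Y = 1" using bezout_linear_powers[OF two] by blast
  let ?J = "K \<times> (UNIV :: bool set)"
  have fin: "finite ?J" using basis_family_finite[OF basis] by simp
  \<comment> \<open>Bezout components of the basis vectors: \<open>B * ?Y\<close> gives the part
    killed by \<open>?X\<close>, and \<open>A * ?X\<close> the part killed by \<open>?Y\<close>.
    They add up to the basis vector, so together they generate.\<close>
  define x0 where "x0 = (\<lambda>(k, s). if s then ev (B * ?Y) (b k) else ev (A * ?X) (b k))"
  define l0 where "l0 = (\<lambda>(k :: 'i, s). if s then d else - d)"
  define n0 where "n0 = (\<lambda>(k :: 'i, s). if s then i else j)"
  have "gen_family ?J x0 l0 n0"
    unfolding gen_family_def
  proof (intro conjI ballI)
    show "generates ?J x0"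
      unfolding generates_def
    proof (intro allI impI)
      fix T assume T: "stable T" and sub: "x0 ` ?J \<subseteq> T"
      have sp: "subspace T" using T by (rule stable_subspace)
      have bT: "b k \<in> T" if "k \<in> K" for k
      proof -
        have "x0 (k, False) + x0 (k, True) \<in> T"
          using sub that by (intro subspace_add[OF sp]) auto
        moreover have "x0 (k, False) + x0 (k, True) = ev (A * ?X + B * ?Y) (b k)"
          by (simp only: x0_def prod.case if_True if_False ev_add)
        ultimately show ?thesis by (simp only: AB ev_1)
      qed
      have "v \<in> T" for v
      proof -
        obtain r where v: "v = (\<Sum>k\<in>K. r k *s b k)" using basis_family_span[OF basis] by blast
        show ?thesis unfolding v by (intro subspace_sum[OF sp] subspace_scale[OF sp] bT)
      qed
      then show "T = UNIV" by blast
    qed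
    fix p assume "p \<in> ?J"
    show "l0 p \<in> {d, - d}" by (cases p) (simp add: l0_def)
    have "ev ?X (ev (B * ?Y) v) = ev (?X * ?Y) (ev B v)" "ev ?Y (ev (A * ?X) v) = ev (?X * ?Y) (ev A v)" for v
      unfolding ev_mult[symmetric] by (simp_all only: mult_ac)
    then have "ev ?X (ev (B * ?Y) v) = 0" "ev ?Y (ev (A * ?X) v) = 0" for v
      by (simp_all only: ann)
    then show "ev ([:- l0 p, 1:] ^ n0 p) (x0 p) = 0"
      by (cases p; cases "snd p") (simp_all only: x0_def l0_def n0_def prod.case if_True if_False snd_conv)
  qed
  then have "\<exists>s. \<exists>x n. gen_family ?J x l0 n \<and> s = (\<Sum>p\<in>?J. n p)" by blast
  then obtain s where s: "\<exists>x n. gen_family ?J x l0 n \<and> s = (\<Sum>p\<in>?J. n p)"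
    and s_min: "\<And>s'. s' < s \<Longrightarrow> \<not> (\<exists>x n. gen_family ?J x l0 n \<and> s' = (\<Sum>p\<in>?J. n p))"
    unfolding exists_least_iff[of "\<lambda>s. \<exists>x n. gen_family ?J x l0 n \<and> s = (\<Sum>p\<in>?J. n p)"] by blast
  obtain x n where gf: "gen_family ?J x l0 n" and s_eq: "s = (\<Sum>p\<in>?J. n p)" using s by blast
  have poly0: "poly (?X * ?Y) 0 \<noteq> 0" using d_nz by simp
  obtain g where g: "\<And>v. u (ev g v) = v" using ex_inverse_poly[OF ann poly0] by blast
  have "cyclic_decomp (?J \<times> (UNIV :: bool set)) (pair_gen x) (\<lambda>(p, e). [:- l0 p, 1:] ^ n p)"
  proof (rule cyclic_decompI)
    show "finite (?J \<times> (UNIV :: bool set))" using fin by simp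
    fix f q assume rel: "(\<Sum>q\<in>?J \<times> (UNIV :: bool set). ev (f q) (pair_gen x q)) = 0"
      and q: "q \<in> ?J \<times> (UNIV :: bool set)"
    obtain p e where pe: "q = (p, e)" by (cases q)
    show "(case q of (p, e) \<Rightarrow> [:- l0 p, 1:] ^ n p) dvd f q"
    proof (rule ccontr)
      assume "\<not> ?thesis"
      then have ndvd: "\<not> [:- l0 p, 1:] ^ n p dvd f (p, e)" by (simp add: pe)
      have p: "p \<in> ?J" using q unfolding pe by (rule SigmaD1)
      obtain x' n' where "gen_family ?J x' l0 n'" and less: "(\<Sum>j\<in>?J. n' j) < (\<Sum>j\<in>?J. n j)"
        using gen_family_reduce[OF fin two gf rel p ndvd] by (elim exE conjE)
      then have ex: "\<exists>x n. gen_family ?J x l0 n \<and> (\<Sum>j\<in>?J. n' j) = (\<Sum>p\<in>?J. n p)"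
        by - (rule exI, rule exI, rule conjI, assumption, rule refl)
      have "(\<Sum>j\<in>?J. n' j) < s" unfolding s_eq by (rule less)
      then show False by (rule notE[OF s_min ex])
    qed
  next
    fix q assume q: "q \<in> ?J \<times> (UNIV :: bool set)"
    obtain p e where pe: "q = (p, e)" by (cases q)
    have p: "l0 p \<in> {d, - d}" "ev ([:- l0 p, 1:] ^ n p) (x p) = 0"
      using gf q pe unfolding gen_family_def by auto
    then show "ev (case q of (p, e) \<Rightarrow> [:- l0 p, 1:] ^ n p) (pair_gen x q) = 0"
      using linear_power_a_zero[of "l0 p" "n p" "x p"] by (auto simp: pe pair_gen_def)
  next
    fix v
    have "generates ?J x" using gf by (simp add: gen_family_def)
    then show "\<exists>f. v = (\<Sum>q\<in>?J \<times> (UNIV :: bool set). ev (f q) (pair_gen x q))"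
      by (rule generates_span[OF fin _ g])
  qed
  then show ?thesis
    by (rule paired_decompI) (auto simp: l0_def)
qed

end

text \<open>With \<gamma>^2 = c the roots are \<plusminus>\<gamma> and \<plusminus>\<gamma>/d. Every
  quotient squares to c / (c/d^2) = d^2, and both signs occur.\<close>

lemma ac_roots_quotients:
  fixes c d :: "'a :: field"
  assumes c: "c \<noteq> 0" and d: "d \<noteq> 0"
  shows "{x * inverse y | x y. x \<in> ac_roots [:- c, 0, 1:] \<and> y \<in> ac_roots [:- (c / d ^ 2), 0, 1:]} =
    {to_ac d, - to_ac d}"
proof -
  have roots: "x \<in> ac_roots [:- k, 0, 1:] \<longleftrightarrow> x ^ 2 = to_ac k" for x :: "'a alg_closure" and k
    by (simp add: ac_roots_def map_poly_pCons power2_eq_square)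
  obtain \<gamma> where \<gamma>: "\<gamma> ^ 2 = to_ac c" using nth_root_exists[of 2 "to_ac c"] by auto
  have nz: "\<gamma> \<noteq> 0" "to_ac d \<noteq> 0" using \<gamma> c d by auto
  show ?thesis
  proof (intro equalityI subsetI)
    fix z assume "z \<in> {x * inverse y | x y. x \<in> ac_roots [:- c, 0, 1:] \<and> y \<in> ac_roots [:- (c / d ^ 2), 0, 1:]}"
    then obtain x y where xy: "z = x * inverse y" "x ^ 2 = to_ac c" "y ^ 2 = to_ac (c / d ^ 2)"
      unfolding roots by blast
    have "z ^ 2 = to_ac c * inverse (to_ac (c / d ^ 2))"
      by (simp only: xy power_mult_distrib power_inverse)
    also have "\<dots> = to_ac d ^ 2" using c nz by simp
    finally show "z \<in> {to_ac d, - to_ac d}" by (auto simp: power2_eq_iff)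
  next
    fix z assume z: "z \<in> {to_ac d, - to_ac d}"
    let ?y = "\<gamma> / to_ac d"
    have y: "?y \<in> ac_roots [:- (c / d ^ 2), 0, 1:]"
      unfolding roots by (simp add: power_divide \<gamma>)
    have x: "\<gamma> \<in> ac_roots [:- c, 0, 1:]" "- \<gamma> \<in> ac_roots [:- c, 0, 1:]"
      unfolding roots by (simp_all add: \<gamma>)
    have "z = \<gamma> * inverse ?y \<or> z = - \<gamma> * inverse ?y" using z nz by (auto simp: field_simps)
    then show "z \<in> {x * inverse y | x y. x \<in> ac_roots [:- c, 0, 1:] \<and> y \<in> ac_roots [:- (c / d ^ 2), 0, 1:]}"
      using x y by blast
  qed
qed

lemma irreducible_quadratic_nonsquare:
  fixes c :: "'a :: field"
  assumes "Factorial_Ring.irreducible [:- c, 0, 1:]"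
  shows "l ^ 2 \<noteq> c"
proof
  assume "l ^ 2 = c"
  then have "[:- c, 0, 1:] = [:- l, 1:] * [:l, 1:]" by (simp add: power2_eq_square)
  then have "[:- l, 1:] dvd 1 \<or> [:l, 1:] dvd 1" using assms by (rule irreducibleD[rotated])
  then show False by (auto simp: is_unit_iff_degree)
qed

lemma quadratic_poly_eq:
  fixes p :: "'a :: field poly"
  assumes "monic p" "Polynomial.degree p = 2" "poly_tr p = 0"
  shows "p = [:Polynomial.coeff p 0, 0, 1:]"
proof (rule poly_eqI)
  fix n :: nat
  consider "n = 0" | "n = 1" | "n = 2" | "n > 2" by linarith
  then show "Polynomial.coeff p n = Polynomial.coeff [:Polynomial.coeff p 0, 0, 1:] n"
  proof cases
    case 2
    then show ?thesis using assms(2,3) by (simp add: poly_tr_def)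
  next
    case 3
    then show ?thesis using assms(1,2) by (simp add: numeral_2_eq_2)
  next
    case 4
    then show ?thesis using assms(2) by (simp add: coeff_eq_0)
  qed simp
qed

lemma neq_minus_self:
  fixes d :: "'a :: field"
  assumes "CHAR('a) \<noteq> 2" "d \<noteq> 0"
  shows "d \<noteq> - d"
proof
  assume "d = - d"
  then have "d + d = 0" by (metis add.right_inverse)
  then have "of_nat 2 * d = 0" by simp
  then have "of_nat 2 = (0 :: 'a)" using assms(2) by simp
  then have "CHAR('a) dvd 2" unfolding of_nat_eq_0_iff_char_dvd .
  then have "CHAR('a) = 1" using assms(1) by (metis prime_nat_iff two_is_prime_nat)
  then show False by simp
qed

text \<open>Each condition is compared with \<open>paired_decomp d\<close>: (ii) and (iii) are
  matrix forms of it, and (i) is linked to it through the map \<open>a\<close> and the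
  eigenvalues.\<close>

theorem theorem4p30:
  fixes p q :: "'a :: field poly" and d :: 'a
    and scale :: "'a \<Rightarrow> 'v :: ab_group_add \<Rightarrow> 'v" and Basis :: "'v set" and u :: "'v \<Rightarrow> 'v"
  assumes "monic p" "Polynomial.degree p = 2" "Factorial_Ring.irreducible p"
    and "monic q" "Polynomial.degree q = 2" "Factorial_Ring.irreducible q"
    and "d \<noteq> 0" "q = H_poly d p"
    and "poly_tr p = 0"
    and "CHAR('a) \<noteq> 2"
    and "finite_dimensional_vector_space scale Basis"
    and "Vector_Spaces.linear scale scale u"
  shows
    "let cond_i = pq_quotient scale p q u \<and> q_exceptional scale p q u;
         cond_ii =
           (\<exists>m n. is_minimal_poly scale u ([:- d, 1:] ^ m * [:d, 1:] ^ n)) \<and>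
           (\<exists>s. is_invariant_factors scale u s \<and> (\<forall>k \<ge> 1. s (2 * k - 1) = s (2 * k)));
         cond_iii =
           (\<exists>bs Bs. represents scale bs (diag_block_mat Bs) u \<and>
             (\<forall>B \<in> set Bs. \<exists>n \<ge> 1.
                B = diag_block_mat [companion_mat ([:- d, 1:] ^ n), companion_mat ([:- d, 1:] ^ n)] \<or>
                B = diag_block_mat [companion_mat ([:d, 1:] ^ n), companion_mat ([:d, 1:] ^ n)]))
     in (cond_i \<longleftrightarrow> cond_ii) \<and> (cond_ii \<longleftrightarrow> cond_iii)"
proof -
  interpret fd: finite_dimensional_vector_space scale Basis by fact
  interpret V: vs_endo scale u
    by (simp add: vs_endo_def vs_endo_axioms_def fd.vector_space_axioms assms(12))
  define c where "c = - Polynomial.coeff p 0"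
  have p: "p = [:- c, 0, 1:]"
    using quadratic_poly_eq[OF assms(1,2,9)] by (simp add: c_def)
  have d: "d \<noteq> 0" by fact
  have q: "q = [:- (c / d ^ 2), 0, 1:]"
    using d unfolding assms(8) p H_poly_def by (simp add: pcompose_pCons power2_eq_square field_simps)
  have nonsquare: "l ^ 2 \<noteq> c" for l
    using irreducible_quadratic_nonsquare assms(3) unfolding p by blast
  have c: "c \<noteq> 0" using nonsquare[of 0] by auto
  have two: "d \<noteq> - d" using neq_minus_self[OF assms(10) d] .
  have exc: "q_exceptional scale p q u \<longleftrightarrow> ac_eigenvalues scale u \<subseteq> {to_ac d, - to_ac d}"
    unfolding q_exceptional_def p q ac_roots_quotients[OF c d] ..
  have basis: "V.basis_family Basis (\<lambda>x. x)"
    using fd.finite_Basis fd.independent_Basis fd.span_Basis by (simp add: V.basis_family_iff)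
  have i: "pq_quotient scale p q u \<and> q_exceptional scale p q u \<longleftrightarrow> V.paired_decomp d"
  proof
    assume i: "pq_quotient scale p q u \<and> q_exceptional scale p q u"
    then obtain a where bij: "bij u" and a: "Vector_Spaces.linear scale scale a" "\<And>v. a (a v) = scale c v"
      "\<And>v. u (a (u v)) = scale (d ^ 2) (a v)"
      unfolding p q V.pq_quotient_iff[OF c d] by blast
    interpret C: conj_endo scale u a c d
      by (intro conj_endo.intro conj_endo_axioms.intro V.vs_endo_axioms a bij d nonsquare)
    obtain bs A where rep: "represents scale bs A u"
      using V.ex_represents[OF fd.finite_Basis fd.independent_Basis fd.span_Basis] by blast
    have "\<exists>m n. \<forall>v. V.ev ([:- d, 1:] ^ m * [:- (- d), 1:] ^ n) v = 0"
    proof (rule V.linear_powers_annihilate[OF basis])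
      fix \<phi> \<gamma> v assume "V.semilin \<phi>" "\<phi> v \<noteq> 0" "\<And>v. \<phi> (u v) = \<gamma> * \<phi> v"
      then have "eigenvalue (map_mat to_ac A) \<gamma>"
        unfolding V.eigenvalue_iff_semilin[OF rep] by blast
      then have "\<gamma> \<in> ac_eigenvalues scale u" unfolding ac_eigenvalues_def using rep by blast
      then show "\<gamma> = to_ac d \<or> \<gamma> = to_ac (- d)" using i unfolding exc by auto
    qed
    then obtain m n where "\<And>v. V.ev ([:- d, 1:] ^ m * [:- (- d), 1:] ^ n) v = 0" by blast
    then show "V.paired_decomp d" by (rule C.conj_imp_paired_decomp[OF basis two])
  next
    assume pd: "V.paired_decomp d"
    obtain N where "\<And>v. V.ev ([:- d, 1:] ^ N * [:d, 1:] ^ N) v = 0"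
      using V.paired_decomp_imp_conjugate(3)[OF d pd] by blast
    then have "q_exceptional scale p q u" unfolding exc by (rule V.ac_eigenvalues_subset)
    moreover have "pq_quotient scale p q u"
      unfolding p q V.pq_quotient_iff[OF c d]
      using V.paired_decomp_imp_conjugate(1,2)[OF d pd] by blast
    ultimately show "pq_quotient scale p q u \<and> q_exceptional scale p q u" by blast
  qed
  have ii: "(\<exists>m n. is_minimal_poly scale u ([:- d, 1:] ^ m * [:d, 1:] ^ n)) \<and>
      (\<exists>s. is_invariant_factors scale u s \<and> (\<forall>k \<ge> 1. s (2 * k - 1) = s (2 * k))) \<longleftrightarrow> V.paired_decomp d"
    using V.invariant_factors_imp_paired_decomp[OF two] V.paired_decomp_imp_invariant_factors[OF two]
    by blast
  show ?thesis
    unfolding Let_def i ii V.represents_pairs_iff by blast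
qed

end
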